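(* Assume (A1)–(A5) hold and that the aggregator satisfies the robustness property (R) at every iteration. Let $$A=\frac{48BL^2c\delta}{p}+\frac{6(1-p)}{p}\Big(\frac{4c\delta}{p}+\frac{1}{2G}\Big)\Big(\omega L^2+\frac{(1+\omega)\mathcal L_\pm^2}{b}\Big)+\frac{6(1-p)}{p}\Big(\frac{4c\delta(1+\omega)}{p}+\frac{\omega}{2G}\Big)L_\pm^2,$$ and suppose $96cB\delta<p$ and $$0<\gamma\le\min\Big\{\frac{1}{L+\sqrt{2A}},\ \frac{p}{4\mu\big(1-\frac{96Bc\delta}{p}\big)}\Big\}.$$ Then for every $K\ge0$ the iterates of Byz-VR-MARINA satisfy $$\mathbb E[f(x^K)-f(x^* )]\le\Big(1-\gamma\mu\Big(1-\frac{96Bc\delta}{p}\Big)\Big)^K\mathbb E[\Phi_0]+\frac{24c\delta\zeta^2}{\mu(p-96Bc\delta)},$$ where $\Phi_0=f(x^0)-f(x^* )+\frac{2\gamma}{p}\|g^0-\nabla f(x^0)\|^2$ and $f(x^* )=\min f$.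
   Context: Setting. There are $n$ workers indexed by $[n]=\mathcal G\sqcup\mathcal B$: $\mathcal G$ is the set of good workers, $G=|\mathcal G|\ge2$, and $\mathcal B$ is the set of Byzantine workers with $|\mathcal B|\le\delta n$, $0\le\delta<1/2$. For $i\in\mathcal G$, $f_i(x)=\frac1m\sum_{j=1}^m f_{i,j}(x)$ with differentiable $f_{i,j}:\mathbb R^d\to\mathbb R$, and $f=\frac1G\sum_{i\in\mathcal G}f_i$. All expectations $\mathbb E$ are full expectations. (A1) $f$ is $L$-smooth ($\|\nabla f(x)-\nabla f(y)\|\le L\|x-y\|$ for all $x,y$) and $f_*=\inf_x f(x)>-\infty$. (A2) ($(B,\zeta^2)$-heterogeneity) For some $B,\zeta\ge0$: $\frac1G\sum_{i\in\mathcal G}\|\nabla f_i(x)-\nabla f(x)\|^2\le B\|\nabla f(x)\|^2+\zeta^2$ for all $x$. (A3) (global Hessian variance) For some $L_\pm\ge0$: $\frac1G\sum_{i\in\mathcal G}\|\nabla f_i(x)-\nabla f_i(y)\|^2-\|\nabla f(x)-\nabla f(y)\|^2\le L_\pm^2\|x-y\|^2$ for all $x,y$. (A4) (local Hessian variance) There is a batch size $b\ge1$ and, for each $i\in\mathcal G$ and $x,y$, a random vector $\widehat\Delta_i(x,y)$ with $\mathbb E[\widehat\Delta_i(x,y)]=\Delta_i(x,y):=\nabla f_i(x)-\nabla f_i(y)$ and $\frac1G\sum_{i\in\mathcal G}\mathbb E\|\widehat\Delta_i(x,y)-\Delta_i(x,y)\|^2\le\frac{\mathcal L_\pm^2}{b}\|x-y\|^2$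 for some $\mathcal L_\pm\ge0$. (A5) (Polyak–Łojasiewicz) For some $\mu>0$ and all $x$, there is a minimizer $x^*$ of $f$ with $\|\nabla f(x)\|^2\ge2\mu(f(x)-f(x^* ))$. Compressor: $\mathcal Q:\mathbb R^d\to\mathbb R^d$ is a stochastic map with $\mathbb E[\mathcal Q(x)]=x$ and $\mathbb E\|\mathcal Q(x)-x\|^2\le\omega\|x\|^2$ for all $x$, for some $\omega\ge0$. Algorithm Byz-VR-MARINA with stepsize $\gamma>0$, probability $p\in(0,1]$, start $x^0$, and initial vector $g^0\in\mathbb R^d$ (possibly random). For $k=0,1,2,\dots$: draw $c_k\sim\mathrm{Bernoulli}(p)$ independently of everything else; set $x^{k+1}=x^k-\gamma g^k$; each good worker $i\in\mathcal G$ sets $g_i^{k+1}=\nabla f_i(x^{k+1})$ if $c_k=1$ and $g_i^{k+1}=g^k+\mathcal Q(\widehat\Delta_i(x^{k+1},x^k))$ if $c_k=0$, where, conditionally on the past and on $c_k$, the estimators $\widehat\Delta_i$ and the compressions are sampled freshly and independently across $i\in\mathcal G$ (the compression being applied with fresh randomness to its input); each Byzantine worker $i\in\mathcal B$ sends an arbitrary vector $g_i^{k+1}$ (which may depend on everything); finally $g^{k+1}=\mathrm{ARAgg}(g_1^{k+1},\dots,g_n^{k+1})$. Robustness property (R) of the aggregator, with constant $c>0$: for every $k\ge0$, $\mathbb E\|g^{k+1}-\bar g^{k+1}\|^2\le\frac{c\delta}{G(G-1)}\sum_{i,l\in\mathcal G}\mathbb E\|g_i^{k+1}-g_l^{k+1}\|^2$,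 where $\bar g^{k+1}=\frac1G\sum_{i\in\mathcal G}g_i^{k+1}$. *)

theory Defs
  imports "HOL-Probability.Probability"
begin

text \<open>Conditional law (given the past and the coin) of the family of compressed
  estimators (Q(hat Delta_i(x', x)))_{i in GG} sent by the good workers:
  independent across good workers, worker i drawing hat Delta_i(x',x) from its
  estimator law D i x' x and then compressing it with the compressor law Qd.\<close>
definition step_kernel ::
  "nat set \<Rightarrow> (nat \<Rightarrow> 'v \<Rightarrow> 'v \<Rightarrow> 'v::euclidean_space measure) \<Rightarrow> ('v \<Rightarrow> 'v measure)
    \<Rightarrow> 'v \<Rightarrow> 'v \<Rightarrow> (nat \<Rightarrow> 'v) measure" where
  "step_kernel GG D Qd x' x = PiM GG (\<lambda>i. bind (D i x' x) Qd)"

end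

theory Submission
  imports Defs
begin

text \<open>The Lyapunov function is \<open>f(x\<^sup>k) - f(x\<^sup>*) + 2\<gamma>/p \<cdot> \<parallel>g\<^sup>k - \<nabla>f(x\<^sup>k)\<parallel>\<^sup>2\<close>.
  The descent lemma for the inexact gradient step bounds its first part. For the second part, Young's
  inequality with parameter \<open>p/2\<close> separates the variance of the average of the good workers' vectors
  from the aggregation error. With probability \<open>p\<close> that variance vanishes; otherwise it is the old
  error plus \<open>1/G\<close> times the mean variance of the independent compressed estimators, which is
  bounded by the squared step length. The aggregation error is bounded through (R) by the pairwise
  dispersion of the good workers: heterogeneity if the coin shows heads, and the same variances plus the
  Hessian variance otherwise. The stepsize condition makes the coefficient of the squared step length
  nonpositive, and the Polyak-Lojasiewicz inequality turns the gradient term into a contraction.\<close>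

subsection \<open>Deterministic inequalities\<close>

text \<open>The start \<open>x 0\<close>, \<open>g 0\<close> may be random without finite second
  moments, so expectations are \<open>ennreal\<close>-valued and the inequalities to be integrated
  have all terms added, none subtracted. An infinite initial Lyapunov value makes the claim trivial;
  otherwise finiteness passes from each step to the next, and the recursion becomes one between real
  sequences.

  Conditional expectations are replaced by the law of the fresh samples on events of the form "past
  event, coin outcome, samples in \<open>S\<close>". This is upgraded once to an identity for
  integrals, after which every estimate is made at fixed endpoints of the step.

  The constants balance as follows. With weight \<open>2 * \<gamma> / p\<close>, the contraction
  \<open>p / 2\<close> of the error pays for the term \<open>\<gamma> / 2\<close> left by the
  descent step and keeps \<open>p / 4\<close>, which is the source of the second stepsize bound.
  Heterogeneity returns \<open>24 * cR * \<delta> * B\<close> times the squared gradient; after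
  weighting, this is the fraction \<open>96 * B * cR * \<delta> / p\<close> of the gain
  \<open>\<gamma> / 2\<close> from descent, so only the remaining fraction drives the
  contraction.\<close>

lemma norm_add_sq_le:
  fixes u v :: "'a::real_inner"
  assumes "s > 0"
  shows "(norm (u + v))\<^sup>2 \<le> (1 + s) * (norm u)\<^sup>2 + (1 + 1 / s) * (norm v)\<^sup>2"
proof -
  have "0 \<le> (norm (s *\<^sub>R u - v))\<^sup>2 / s"
    using assms by simp
  also have "(norm (s *\<^sub>R u - v))\<^sup>2 = s\<^sup>2 * (norm u)\<^sup>2 - 2 * s * (u \<bullet> v) + (norm v)\<^sup>2"
    unfolding power2_norm_eq_inner
    by (simp add: inner_diff_left inner_diff_right inner_commute power2_eq_square)
  also have "\<dots> / s = s * (norm u)\<^sup>2 - 2 * (u \<bullet> v) + (norm v)\<^sup>2 / s"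
    using assms by (simp add: field_simps power2_eq_square)
  finally show ?thesis
    unfolding power2_norm_eq_inner
    by (simp add: inner_add_left inner_add_right inner_commute algebra_simps)
qed

lemma norm_add_sq_le_double:
  fixes u v :: "'a::real_inner"
  shows "(norm (u + v))\<^sup>2 \<le> 2 * (norm u)\<^sup>2 + 2 * (norm v)\<^sup>2"
  using norm_add_sq_le[of 1 u v] by simp

lemma sum_sum_norm_diff_sq:
  fixes a :: "'i \<Rightarrow> 'a::real_inner"
  assumes "finite I"
  shows "(\<Sum>i\<in>I. \<Sum>l\<in>I. (norm (a i - a l))\<^sup>2)
    = 2 * real (card I) * (\<Sum>i\<in>I. (norm (a i))\<^sup>2) - 2 * (norm (\<Sum>i\<in>I. a i))\<^sup>2"
proof -
  have "(\<Sum>i\<in>I. \<Sum>l\<in>I. (norm (a i - a l))\<^sup>2)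
    = (\<Sum>i\<in>I. \<Sum>l\<in>I. (norm (a i))\<^sup>2 + (norm (a l))\<^sup>2 - 2 * (a i \<bullet> a l))"
    unfolding power2_norm_eq_inner
    by (intro sum.cong refl) (simp add: inner_diff_left inner_diff_right inner_commute)
  also have "\<dots> = 2 * real (card I) * (\<Sum>i\<in>I. (norm (a i))\<^sup>2) - 2 * (\<Sum>i\<in>I. \<Sum>l\<in>I. a i \<bullet> a l)"
    by (simp add: sum.distrib sum_subtractf sum_distrib_left[symmetric] algebra_simps)
  also have "(\<Sum>i\<in>I. \<Sum>l\<in>I. a i \<bullet> a l) = (norm (\<Sum>i\<in>I. a i))\<^sup>2"
    unfolding power2_norm_eq_inner by (simp add: inner_sum_left inner_sum_right inner_commute)
  finally show ?thesis .
qed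

lemma sum_norm_diff_mean_sq:
  fixes a :: "'i \<Rightarrow> 'a::real_inner"
  assumes "finite I" "I \<noteq> {}"
  defines "m \<equiv> (1 / real (card I)) *\<^sub>R (\<Sum>i\<in>I. a i)"
  shows "(\<Sum>i\<in>I. (norm (a i - m))\<^sup>2) = (\<Sum>i\<in>I. (norm (a i))\<^sup>2) - real (card I) * (norm m)\<^sup>2"
proof -
  have c: "real (card I) \<noteq> 0" using assms by simp
  have m: "(\<Sum>i\<in>I. a i) = real (card I) *\<^sub>R m" using c by (simp add: m_def)
  have "(\<Sum>i\<in>I. (norm (a i - m))\<^sup>2) = (\<Sum>i\<in>I. (norm (a i))\<^sup>2 + (norm m)\<^sup>2 - 2 * (a i \<bullet> m))"
    unfolding power2_norm_eq_inner
    by (intro sum.cong refl) (simp add: inner_diff_left inner_diff_right inner_commute)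
  also have "\<dots> = (\<Sum>i\<in>I. (norm (a i))\<^sup>2) + real (card I) * (norm m)\<^sup>2 - 2 * ((\<Sum>i\<in>I. a i) \<bullet> m)"
    by (simp add: sum.distrib sum_subtractf sum_distrib_left[symmetric] inner_sum_left)
  also have "\<dots> = (\<Sum>i\<in>I. (norm (a i))\<^sup>2) - real (card I) * (norm m)\<^sup>2"
    by (simp add: m power2_norm_eq_inner)
  finally show ?thesis .
qed

text \<open>This translates between the two ways in which dispersion is measured: (R) uses pairwise
  differences, while (A2) and (A3) control deviations from the mean.\<close>

lemma sum_sum_norm_diff_sq_mean:
  fixes a :: "'i \<Rightarrow> 'a::real_inner"
  assumes "finite I" "I \<noteq> {}"
  shows "(\<Sum>i\<in>I. \<Sum>l\<in>I. (norm (a i - a l))\<^sup>2)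
    = 2 * real (card I) * (\<Sum>i\<in>I. (norm (a i - (1 / real (card I)) *\<^sub>R (\<Sum>i\<in>I. a i)))\<^sup>2)"
proof -
  have c: "real (card I) \<noteq> 0" using assms by simp
  show ?thesis
    unfolding sum_sum_norm_diff_sq[OF assms(1)] sum_norm_diff_mean_sq[OF assms]
    using c by (simp add: power_divide field_simps power2_eq_square)
qed

text \<open>The auxiliary \<open>\<phi>\<close> is \<open>f\<close> along the segment from
  \<open>x\<close> to \<open>y\<close> minus the linear and quadratic terms of the bound.
  Cauchy-Schwarz and the Lipschitz gradient make its derivative nonpositive, so comparing the two
  endpoints suffices and no gradient has to be integrated.\<close>

lemma smooth_upper_bound:
  fixes f :: "'a::real_inner \<Rightarrow> real"
  assumes grad: "\<And>z. GDERIV f z :> df z"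
    and lip: "\<And>y z. norm (df y - df z) \<le> L * norm (y - z)"
  shows "f y \<le> f x + df x \<bullet> (y - x) + L / 2 * (norm (y - x))\<^sup>2"
proof -
  define d where "d = y - x"
  define \<phi> where "\<phi> t = f (x + t *\<^sub>R d) - t * (df x \<bullet> d) - L / 2 * t\<^sup>2 * (norm d)\<^sup>2" for t
  have der: "DERIV \<phi> t :> (df (x + t *\<^sub>R d) - df x) \<bullet> d - L * t * (norm d)\<^sup>2" for t
  proof -
    have "((\<lambda>t. x + t *\<^sub>R d) has_derivative (\<lambda>h. h *\<^sub>R d)) (at t)"
      by (auto intro!: derivative_eq_intros)
    moreover have "(f has_derivative (\<lambda>h. h \<bullet> df (x + t *\<^sub>R d))) (at (x + t *\<^sub>R d))"
      using grad unfolding gderiv_def .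
    ultimately have "((\<lambda>t. f (x + t *\<^sub>R d)) has_derivative (\<lambda>h. (h *\<^sub>R d) \<bullet> df (x + t *\<^sub>R d))) (at t)"
      by (rule has_derivative_compose)
    then have "DERIV (\<lambda>t. f (x + t *\<^sub>R d)) t :> df (x + t *\<^sub>R d) \<bullet> d"
      by (simp add: has_field_derivative_def inner_commute mult.commute[of _ "_ \<bullet> _"])
    then show ?thesis
      unfolding \<phi>_def by (auto intro!: derivative_eq_intros simp: inner_diff_left)
  qed
  have "\<phi> 1 \<le> \<phi> 0"
  proof (rule DERIV_nonpos_imp_nonincreasing[where f = \<phi>])
    fix t :: real assume t: "0 \<le> t" "t \<le> 1"
    have "(df (x + t *\<^sub>R d) - df x) \<bullet> d \<le> norm (df (x + t *\<^sub>R d) - df x) * norm d"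
      by (rule norm_cauchy_schwarz)
    also have "\<dots> \<le> (L * norm (x + t *\<^sub>R d - x)) * norm d"
      by (intro mult_right_mono lip norm_ge_zero)
    also have "\<dots> = L * t * (norm d)\<^sup>2"
      using t by (simp add: power2_eq_square)
    finally show "\<exists>D. DERIV \<phi> t :> D \<and> D \<le> 0"
      using der[of t] by (intro exI[of _ "(df (x + t *\<^sub>R d) - df x) \<bullet> d - L * t * (norm d)\<^sup>2"]) simp
  qed simp
  then show ?thesis by (simp add: \<phi>_def d_def)
qed

text \<open>Polarization rewrites the inner product of \<open>df x\<close> and \<open>g\<close>
  through squares, so the inexactness enters only as \<open>norm (g - df x)\<close>. The gains stand
  on the left with plus signs; once their coefficients are nonnegative the inequality can be
  integrated in \<open>ennreal\<close>.\<close>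

lemma inexact_gradient_descent:
  fixes f :: "'a::real_inner \<Rightarrow> real"
  assumes grad: "\<And>z. GDERIV f z :> df z"
    and lip: "\<And>y z. norm (df y - df z) \<le> L * norm (y - z)"
    and gamma: "\<gamma> > 0" and y: "y = x - \<gamma> *\<^sub>R g"
  shows "f y + \<gamma> / 2 * (norm (df x))\<^sup>2 + (1 / (2 * \<gamma>) - L / 2) * (norm (y - x))\<^sup>2
    \<le> f x + \<gamma> / 2 * (norm (g - df x))\<^sup>2"
proof -
  have "f y \<le> f x + df x \<bullet> (y - x) + L / 2 * (norm (y - x))\<^sup>2"
    by (rule smooth_upper_bound[OF grad lip])
  moreover have "df x \<bullet> (y - x) = - \<gamma> * (df x \<bullet> g)" by (simp add: y)
  moreover have "1 / (2 * \<gamma>) * (norm (y - x))\<^sup>2 = \<gamma> / 2 * (norm g)\<^sup>2"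
    using gamma by (simp add: y power_mult_distrib power2_eq_square)
  moreover have "\<gamma> / 2 * (norm (g - df x))\<^sup>2
      = \<gamma> / 2 * (norm g)\<^sup>2 - \<gamma> * (df x \<bullet> g) + \<gamma> / 2 * (norm (df x))\<^sup>2"
    unfolding power2_norm_eq_inner
    by (simp add: inner_diff_left inner_diff_right inner_commute algebra_simps)
  ultimately show ?thesis unfolding left_diff_distrib by linarith
qed

text \<open>The sequences stand for the expected function gap, squared gradient error, squared step
  length and squared gradient. The combination is descent plus \<open>2 * \<gamma> / p\<close> times
  the error recursion; \<open>1 - \<theta>\<close> is then the share of the descent gain
  \<open>\<gamma> / 2 * N k\<close> that heterogeneity takes back.\<close>

lemma lyapunov_recursion:
  fixes a e r N :: "nat \<Rightarrow> real"
  assumes nn: "\<And>k. a k \<ge> 0" "\<And>k. e k \<ge> 0" "\<And>k. r k \<ge> 0" "\<And>k. N k \<ge> 0"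
    and descent: "\<And>k. a (Suc k) + \<gamma> / 2 * N k + (1 / (2 * \<gamma>) - L / 2) * r k \<le> a k + \<gamma> / 2 * e k"
    and error: "\<And>k. e (Suc k) \<le> (1 - p / 2) * e k + p * (1 - \<theta>) / 4 * N k + p * A / 2 * r k + \<eta>"
    and PL: "\<And>k. 2 * \<mu> * a k \<le> N k"
    and p: "0 < p" "p \<le> 1" and \<theta>: "\<theta> > 0" and \<gamma>: "\<gamma> > 0" and \<mu>: "\<mu> > 0"
    and \<gamma>1: "2 * \<gamma>\<^sup>2 * A + \<gamma> * L \<le> 1" and \<gamma>2: "\<gamma> * \<mu> * \<theta> \<le> p / 4" and \<eta>: "\<eta> \<ge> 0"
  shows "a K + 2 * \<gamma> / p * e K
    \<le> (1 - \<gamma> * \<mu> * \<theta>) ^ K * (a 0 + 2 * \<gamma> / p * e 0) + 2 * \<eta> / (p * \<mu> * \<theta>)"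
proof (induction K)
  case 0
  show ?case using p \<theta> \<mu> \<eta> by simp
next
  case (Suc k)
  define \<rho> where "\<rho> = 1 - \<gamma> * \<mu> * \<theta>"
  define E where "E = 2 * \<eta> / (p * \<mu> * \<theta>)"
  have \<rho>: "\<rho> \<ge> 0" using \<gamma>2 p by (simp add: \<rho>_def)
  have "2 * \<gamma> / p * e (Suc k)
      \<le> 2 * \<gamma> / p * ((1 - p / 2) * e k + p * (1 - \<theta>) / 4 * N k + p * A / 2 * r k + \<eta>)"
    using \<gamma> p by (intro mult_left_mono error) auto
  also have "\<dots> = 2 * \<gamma> / p * (1 - p / 2) * e k + \<gamma> / 2 * (1 - \<theta>) * N k + \<gamma> * A * r k + 2 * \<gamma> / p * \<eta>"
    using p by (simp add: field_simps)
  finally have 1: "a (Suc k) + 2 * \<gamma> / p * e (Suc k) \<le> a k + \<gamma> / 2 * e k + 2 * \<gamma> / p * (1 - p / 2) * e k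
      - \<gamma> / 2 * \<theta> * N k - (1 / (2 * \<gamma>) - L / 2 - \<gamma> * A) * r k + 2 * \<gamma> / p * \<eta>"
    using descent[of k] by (simp only: left_diff_distrib right_diff_distrib mult_1_right)
  \<comment> \<open>The weighted error recursion feeds back \<open>\<gamma> * A * r k\<close>. What
    is left of the step-length coefficient is nonnegative by \<open>\<gamma>1\<close>.\<close>
  have "1 / (2 * \<gamma>) - L / 2 - \<gamma> * A = (1 - (2 * \<gamma>\<^sup>2 * A + \<gamma> * L)) / (2 * \<gamma>)"
    using \<gamma> by (simp add: field_simps power2_eq_square)
  then have 2: "0 \<le> (1 / (2 * \<gamma>) - L / 2 - \<gamma> * A) * r k"
    using \<gamma> \<gamma>1 nn(3) by simp
  have 3: "\<gamma> * \<mu> * \<theta> * a k \<le> \<gamma> / 2 * \<theta> * N k"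
    using mult_left_mono[OF PL[of k], of "\<gamma> / 2 * \<theta>"] \<gamma> \<theta> by (simp add: mult_ac)
  \<comment> \<open>Since \<open>\<gamma> / 2\<close> is \<open>2 * \<gamma> / p\<close> times
    \<open>p / 4\<close>, the descent error uses up half of the contraction \<open>p / 2\<close>; by
    \<open>\<gamma>2\<close> the rate \<open>\<rho>\<close> fits into the other half.\<close>
  have "\<gamma> / 2 * e k + 2 * \<gamma> / p * (1 - p / 2) * e k = 2 * \<gamma> / p * ((1 - p / 4) * e k)"
    using p by (simp add: field_simps)
  also have "\<dots> \<le> 2 * \<gamma> / p * (\<rho> * e k)"
    using \<gamma> p \<gamma>2 nn(2) by (intro mult_left_mono mult_right_mono) (auto simp: \<rho>_def)
  finally have 4: "\<gamma> / 2 * e k + 2 * \<gamma> / p * (1 - p / 2) * e k \<le> 2 * \<gamma> / p * (\<rho> * e k)" .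
  have "a (Suc k) + 2 * \<gamma> / p * e (Suc k) \<le> \<rho> * (a k + 2 * \<gamma> / p * e k) + 2 * \<gamma> / p * \<eta>"
  proof -
    have "\<rho> * (a k + 2 * \<gamma> / p * e k) = a k - \<gamma> * \<mu> * \<theta> * a k + 2 * \<gamma> / p * (\<rho> * e k)"
      using p by (simp add: \<rho>_def field_simps)
    with 1 2 3 show ?thesis
      using 4 by linarith
  qed
  also have "\<dots> \<le> \<rho> * (\<rho> ^ k * (a 0 + 2 * \<gamma> / p * e 0) + E) + 2 * \<gamma> / p * \<eta>"
    using Suc \<rho> by (intro add_right_mono mult_left_mono) (auto simp: \<rho>_def E_def)
  \<comment> \<open>\<open>E\<close> was chosen as the fixed point of the map
    \<open>t \<mapsto> \<rho> * t + 2 * \<gamma> / p * \<eta>\<close>, that is, as the sum of the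
    geometric series of noise contributions.\<close>
  also have "\<rho> * E + 2 * \<gamma> / p * \<eta> = E"
    using \<theta> \<mu> p by (simp add: \<rho>_def E_def field_simps)
  then have "\<rho> * (\<rho> ^ k * (a 0 + 2 * \<gamma> / p * e 0) + E) + 2 * \<gamma> / p * \<eta>
      = \<rho> ^ Suc k * (a 0 + 2 * \<gamma> / p * e 0) + E"
    by (simp add: algebra_simps)
  finally show ?case by (simp add: \<rho>_def E_def)
qed

lemma stepsize_quadratic:
  fixes L A \<gamma> :: real
  assumes "L \<ge> 0" "A \<ge> 0" "\<gamma> > 0" "\<gamma> \<le> 1 / (L + sqrt (2 * A))"
  shows "2 * \<gamma>\<^sup>2 * A + \<gamma> * L \<le> 1"
proof -
  define s where "s = \<gamma> * sqrt (2 * A)"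
  \<comment> \<open>If this sum were 0, division by zero would turn the stepsize bound into
    \<open>\<gamma> \<le> 0\<close>.\<close>
  have "L + sqrt (2 * A) > 0"
    using assms by (metis add_nonneg_nonneg div_by_0 le_less linorder_not_less mult_nonneg_nonneg real_sqrt_ge_0_iff zero_le_numeral)
  then have le: "\<gamma> * L + s \<le> 1"
    using assms(4) by (simp add: s_def field_simps)
  have "0 \<le> s" "0 \<le> \<gamma> * L" using assms by (auto simp: s_def)
  then have "s\<^sup>2 \<le> s" using le by (simp add: power2_eq_square mult_left_le)
  moreover have "s\<^sup>2 = 2 * \<gamma>\<^sup>2 * A" using assms by (simp add: s_def power_mult_distrib)
  ultimately show ?thesis using le by simp
qed

subsection \<open>Second moments of compressed estimators\<close>

text \<open>The two squares differ by an integrable function whose linear part has mean zero. Hence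
  either both second moments are finite and the usual bias-variance identity holds, or both are
  infinite and the identity is trivial.\<close>

lemma nn_integral_norm_diff_sq:
  fixes m a :: "'v::euclidean_space"
  assumes "prob_space M" and sets: "sets M = sets borel" and int: "integrable M (\<lambda>u. u)" and mean: "(\<integral>u. u \<partial>M) = m"
  shows "(\<integral>\<^sup>+u. ennreal ((norm (u - a))\<^sup>2) \<partial>M)
    = ennreal ((norm (m - a))\<^sup>2) + (\<integral>\<^sup>+u. ennreal ((norm (u - m))\<^sup>2) \<partial>M)"
proof -
  interpret prob_space M by fact
  have [measurable]: "h \<in> borel_measurable M" if "h \<in> borel_measurable borel" for h :: "'v \<Rightarrow> real"
    using that by (simp add: measurable_cong_sets[OF sets refl])
  have m_eq: "(\<lambda>u. (norm (u - a))\<^sup>2)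
      = (\<lambda>u. (norm (u - m))\<^sup>2 + 2 * ((u - m) \<bullet> (m - a)) + (norm (m - a))\<^sup>2)"
    unfolding power2_norm_eq_inner
    by (simp add: inner_diff_left inner_diff_right inner_commute algebra_simps)
  have lin: "integrable M (\<lambda>u. (u - m) \<bullet> (m - a))" "(\<integral>u. (u - m) \<bullet> (m - a) \<partial>M) = 0"
    using int by (auto simp: mean prob_space inner_diff_left)
  show ?thesis
  proof (cases "integrable M (\<lambda>u. (norm (u - m))\<^sup>2)")
    case True
    have 1: "integrable M (\<lambda>u. (norm (u - a))\<^sup>2)"
      unfolding m_eq using True lin(1) by simp
    have "(\<integral>u. (norm (u - a))\<^sup>2 \<partial>M) = (norm (m - a))\<^sup>2 + (\<integral>u. (norm (u - m))\<^sup>2 \<partial>M)"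
      unfolding m_eq using True lin by (simp add: prob_space)
    then show ?thesis
      using True 1 by (simp add: nn_integral_eq_integral ennreal_plus[symmetric] del: ennreal_plus)
  next
    case False
    have "\<not> integrable M (\<lambda>u. (norm (u - a))\<^sup>2)"
    proof
      assume "integrable M (\<lambda>u. (norm (u - a))\<^sup>2)"
      then have "integrable M (\<lambda>u. (norm (u - m))\<^sup>2 + 2 * ((u - m) \<bullet> (m - a)) + (norm (m - a))\<^sup>2
          - 2 * ((u - m) \<bullet> (m - a)) - (norm (m - a))\<^sup>2)"
        unfolding m_eq by (intro Bochner_Integration.integrable_diff) (use lin(1) in simp_all)
      then show False using False by simp
    qed
    with False have "(\<integral>\<^sup>+u. ennreal ((norm (u - m))\<^sup>2) \<partial>M) = \<infinity>" "(\<integral>\<^sup>+u. ennreal ((norm (u - a))\<^sup>2) \<partial>M) = \<infinity>"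
      by (auto simp: integrable_iff_bounded less_top[symmetric])
    then show ?thesis by simp
  qed
qed

text \<open>This is the tower property for a vector-valued mean. Integration over
  \<open>bind\<close> is available for nonnegative integrands, so each coordinate is split into its
  positive and negative part.\<close>

lemma integral_bind_unbiased:
  fixes K :: "'v::euclidean_space \<Rightarrow> 'v measure"
  assumes P: "P \<in> space (prob_algebra borel)" and K: "K \<in> borel \<rightarrow>\<^sub>M prob_algebra borel"
    and K_int: "\<And>v. integrable (K v) (\<lambda>u. u)" and K_mean: "\<And>v. (\<integral>u. u \<partial>K v) = v"
    and P_int: "integrable P (\<lambda>v. v)"
    and bind_int: "integrable (bind P K) (\<lambda>u. u)"
  shows "(\<integral>u. u \<partial>bind P K) = (\<integral>v. v \<partial>P)"
proof (rule euclidean_eqI)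
  fix e :: 'v assume e: "e \<in> Basis"
  have sP: "sets P = sets borel"
    using P by (simp add: space_prob_algebra)
  have [measurable]: "K \<in> P \<rightarrow>\<^sub>M subprob_algebra borel"
    using measurable_prob_algebraD[OF K] by (simp add: measurable_cong_sets[OF sP refl])
  \<comment> \<open>The values \<open>s = 1\<close> and \<open>s = - 1\<close> give the positive and
    the negative part of the coordinate along \<open>e\<close>.\<close>
  have coord: "(\<integral>u. max 0 (s * (u \<bullet> e)) \<partial>bind P K) = (\<integral>v. (\<integral>u. max 0 (s * (u \<bullet> e)) \<partial>K v) \<partial>P)"
    and coordI: "integrable P (\<lambda>v. (\<integral>u. max 0 (s * (u \<bullet> e)) \<partial>K v))" for s :: real
  proof -
    have Ki: "integrable (K v) (\<lambda>u. max 0 (s * (u \<bullet> e)))" for v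
      using K_int[of v] by simp
    have bi: "integrable (bind P K) (\<lambda>u. max 0 (s * (u \<bullet> e)))"
      using bind_int by simp
    have meas: "(\<lambda>v. (\<integral>u. max 0 (s * (u \<bullet> e)) \<partial>K v)) \<in> borel_measurable P"
      by (rule measurable_compose[OF \<open>K \<in> P \<rightarrow>\<^sub>M _\<close> integral_measurable_subprob_algebra]) simp
    have nn: "(\<integral>\<^sup>+u. ennreal (max 0 (s * (u \<bullet> e))) \<partial>bind P K)
        = (\<integral>\<^sup>+v. ennreal (\<integral>u. max 0 (s * (u \<bullet> e)) \<partial>K v) \<partial>P)"
    proof -
      have "(\<integral>\<^sup>+u. ennreal (max 0 (s * (u \<bullet> e))) \<partial>bind P K)
          = (\<integral>\<^sup>+v. (\<integral>\<^sup>+u. ennreal (max 0 (s * (u \<bullet> e))) \<partial>K v) \<partial>P)"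
        by (rule nn_integral_bind[where B = borel]) measurable
      also have "\<dots> = (\<integral>\<^sup>+v. ennreal (\<integral>u. max 0 (s * (u \<bullet> e)) \<partial>K v) \<partial>P)"
        by (intro nn_integral_cong nn_integral_eq_integral Ki) (rule AE_I2, rule max.cobounded1)
      finally show ?thesis .
    qed
    show "(\<integral>u. max 0 (s * (u \<bullet> e)) \<partial>bind P K) = (\<integral>v. (\<integral>u. max 0 (s * (u \<bullet> e)) \<partial>K v) \<partial>P)"
    proof -
      have "(\<integral>u. max 0 (s * (u \<bullet> e)) \<partial>bind P K)
          = enn2real (\<integral>\<^sup>+u. ennreal (max 0 (s * (u \<bullet> e))) \<partial>bind P K)"
        by (rule integral_eq_nn_integral[OF borel_measurable_integrable[OF bi]])
           (rule AE_I2, rule max.cobounded1)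
      also have "\<dots> = (\<integral>v. (\<integral>u. max 0 (s * (u \<bullet> e)) \<partial>K v) \<partial>P)"
        unfolding nn by (rule integral_eq_nn_integral[OF meas, symmetric])
          (rule AE_I2, rule Bochner_Integration.integral_nonneg, rule max.cobounded1)
      finally show ?thesis .
    qed
    have "(\<integral>\<^sup>+v. ennreal (\<integral>u. max 0 (s * (u \<bullet> e)) \<partial>K v) \<partial>P) < \<infinity>"
      unfolding nn[symmetric] using bi by (simp add: integrable_iff_bounded)
    then show "integrable P (\<lambda>v. (\<integral>u. max 0 (s * (u \<bullet> e)) \<partial>K v))"
      using meas by (intro integrableI_nonneg) auto
  qed
  have split: "(u \<bullet> e) = max 0 (1 * (u \<bullet> e)) - max 0 (- 1 * (u \<bullet> e))" for u by simp
  have "(\<integral>u. u \<partial>bind P K) \<bullet> e = (\<integral>u. u \<bullet> e \<partial>bind P K)"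
    using bind_int by (simp add: integral_inner_left)
  also have "\<dots> = (\<integral>u. max 0 (1 * (u \<bullet> e)) \<partial>bind P K) - (\<integral>u. max 0 (- 1 * (u \<bullet> e)) \<partial>bind P K)"
    by (subst split, rule Bochner_Integration.integral_diff) (use bind_int in auto)
  also have "\<dots> = (\<integral>v. (\<integral>u. max 0 (1 * (u \<bullet> e)) \<partial>K v) - (\<integral>u. max 0 (- 1 * (u \<bullet> e)) \<partial>K v) \<partial>P)"
    unfolding coord by (rule Bochner_Integration.integral_diff[symmetric]) (rule coordI)+
  also have "\<dots> = (\<integral>v. (\<integral>u. u \<bullet> e \<partial>K v) \<partial>P)"
    by (intro Bochner_Integration.integral_cong refl)
       (subst (3) split, rule Bochner_Integration.integral_diff[symmetric], use K_int in auto)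
  also have "\<dots> = (\<integral>v. v \<bullet> e \<partial>P)"
    using K_int by (simp add: integral_inner_left K_mean)
  also have "\<dots> = (\<integral>v. v \<partial>P) \<bullet> e"
    using P_int by (simp add: integral_inner_left)
  finally show "(\<integral>u. u \<partial>bind P K) \<bullet> e = (\<integral>v. v \<partial>P) \<bullet> e" .
qed

lemma integrable_of_second_moment:
  fixes a :: "'v::euclidean_space"
  assumes "P \<in> space (prob_algebra borel)" and fin: "(\<integral>\<^sup>+u. ennreal ((norm (u - a))\<^sup>2) \<partial>P) < \<infinity>"
  shows "integrable P (\<lambda>u. u)"
proof -
  interpret prob_space P using assms by (simp add: space_prob_algebra)
  have [measurable_cong]: "sets P = sets borel" using assms by (simp add: space_prob_algebra)
  have "integrable P (\<lambda>u. (norm (u - a))\<^sup>2)"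
    using fin by (simp add: integrable_iff_bounded)
  then have "integrable P (\<lambda>u. norm (u - a))"
    by (rule square_integrable_imp_integrable[rotated]) measurable
  then have "integrable P (\<lambda>u. (u - a) + a)"
    by (intro Bochner_Integration.integrable_add) (auto simp: integrable_norm_iff)
  then show ?thesis by simp
qed

text \<open>For a given estimate \<open>v\<close>, unbiasedness of the compressor splits the squared
  distance to \<open>m\<close> into that of \<open>v\<close> and the compression variance, at most
  \<open>om * (norm v)\<^sup>2\<close>. The second moment of \<open>v\<close> is the squared norm of
  \<open>m\<close> plus \<open>s\<close>, so \<open>s\<close> is counted once directly and
  \<open>om\<close> times through the compression.\<close>

lemma bind_unbiased_compressor:
  fixes K :: "'v::euclidean_space \<Rightarrow> 'v measure"
  assumes P: "P \<in> space (prob_algebra borel)" and K: "K \<in> borel \<rightarrow>\<^sub>M prob_algebra borel"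
    and K_int: "\<And>v. integrable (K v) (\<lambda>u. u)" and K_mean: "\<And>v. (\<integral>u. u \<partial>K v) = v"
    and K_var: "\<And>v. (\<integral>\<^sup>+u. ennreal ((norm (u - v))\<^sup>2) \<partial>K v) \<le> ennreal (om * (norm v)\<^sup>2)"
    and P_int: "integrable P (\<lambda>v. v)" and P_mean: "(\<integral>v. v \<partial>P) = m"
    and P_var: "(\<integral>\<^sup>+v. ennreal ((norm (v - m))\<^sup>2) \<partial>P) = ennreal s" and s: "s \<ge> 0" and om: "om \<ge> 0"
  shows "bind P K \<in> space (prob_algebra borel)"
    and "integrable (bind P K) (\<lambda>u. u)"
    and "(\<integral>u. u \<partial>bind P K) = m"
    and "(\<integral>\<^sup>+u. ennreal ((norm (u - m))\<^sup>2) \<partial>bind P K) \<le> ennreal ((1 + om) * s + om * (norm m)\<^sup>2)"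
proof -
  show bnd: "bind P K \<in> space (prob_algebra borel)"
    using prob_space_bind'[OF P K] sets_bind'[OF P K] by (simp add: space_prob_algebra)
  interpret P: prob_space P using P by (simp add: space_prob_algebra)
  have sP[measurable_cong]: "sets P = sets borel" and sK: "sets (K v) = sets borel" for v
    using P measurable_space[OF K, of v] by (auto simp: space_prob_algebra)
  have pK: "prob_space (K v)" for v
    using measurable_space[OF K, of v] by (auto simp: space_prob_algebra)
  have Km: "K \<in> P \<rightarrow>\<^sub>M subprob_algebra borel"
    using measurable_prob_algebraD[OF K] by (simp add: measurable_cong_sets[OF sP refl])
  have "(\<integral>\<^sup>+u. ennreal ((norm (u - m))\<^sup>2) \<partial>bind P K)
      = (\<integral>\<^sup>+v. (\<integral>\<^sup>+u. ennreal ((norm (u - m))\<^sup>2) \<partial>K v) \<partial>P)"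
    by (rule nn_integral_bind[OF _ Km]) simp
  also have "\<dots> = (\<integral>\<^sup>+v. ennreal ((norm (v - m))\<^sup>2) + (\<integral>\<^sup>+u. ennreal ((norm (u - v))\<^sup>2) \<partial>K v) \<partial>P)"
    by (intro nn_integral_cong nn_integral_norm_diff_sq pK sK K_int K_mean)
  \<comment> \<open>Writing \<open>v\<close> as \<open>v - 0\<close> lets the bias-variance identity
    around \<open>a = 0\<close> compute the second moment of \<open>P\<close> below.\<close>
  also have "\<dots> \<le> (\<integral>\<^sup>+v. ennreal ((norm (v - m))\<^sup>2) + ennreal om * ennreal ((norm (v - 0))\<^sup>2) \<partial>P)"
    using om by (intro nn_integral_mono add_left_mono order_trans[OF K_var]) (simp add: ennreal_mult)
  also have "\<dots> = ennreal s + ennreal om * (\<integral>\<^sup>+v. ennreal ((norm (v - 0))\<^sup>2) \<partial>P)"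
    by (simp add: nn_integral_add nn_integral_cmult P_var)
  also have "(\<integral>\<^sup>+v. ennreal ((norm (v - 0))\<^sup>2) \<partial>P) = ennreal ((norm (m - 0))\<^sup>2) + ennreal s"
    by (subst nn_integral_norm_diff_sq[OF P.prob_space_axioms sP P_int P_mean]) (simp add: P_var)
  also have "ennreal s + ennreal om * (ennreal ((norm (m - 0))\<^sup>2) + ennreal s)
      = ennreal ((1 + om) * s + om * (norm m)\<^sup>2)"
    using s om by (simp add: ennreal_mult[symmetric] ennreal_plus[symmetric] algebra_simps del: ennreal_plus)
  finally show var: "(\<integral>\<^sup>+u. ennreal ((norm (u - m))\<^sup>2) \<partial>bind P K) \<le> ennreal ((1 + om) * s + om * (norm m)\<^sup>2)" .
  \<comment> \<open>Integrability under every single \<open>K v\<close> does not give integrability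
    under the mixture, so it is read off the variance bound. The mean comes last because it
    presupposes integrability.\<close>
  then have "(\<integral>\<^sup>+u. ennreal ((norm (u - m))\<^sup>2) \<partial>bind P K) < \<infinity>"
    using order.strict_trans1 ennreal_less_top by (metis infinity_ennreal_def)
  then show int: "integrable (bind P K) (\<lambda>u. u)"
    by (rule integrable_of_second_moment[OF bnd])
  show "(\<integral>u. u \<partial>bind P K) = m"
    using integral_bind_unbiased[OF P K K_int K_mean P_int int] P_mean by simp
qed

text \<open>Independence removes all cross terms. The offset \<open>e\<close>, the subset
  \<open>S\<close> and the weights \<open>c\<close> serve two applications: the average of all
  workers, with \<open>S = I\<close> and equal weights, and the difference of two workers, with
  \<open>S = {i, l}\<close> and weights 1 and -1.\<close>

lemma nn_integral_PiM_norm_sq: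
  fixes P :: "'i \<Rightarrow> 'v::euclidean_space measure"
  assumes I: "finite I" and S: "S \<subseteq> I"
    and P: "\<And>i. i \<in> I \<Longrightarrow> P i \<in> space (prob_algebra borel)"
    and int: "\<And>i. i \<in> I \<Longrightarrow> integrable (P i) (\<lambda>u. u)"
    and mean: "\<And>i. i \<in> I \<Longrightarrow> (\<integral>u. u \<partial>P i) = m i"
    and var: "\<And>i. i \<in> I \<Longrightarrow> (\<integral>\<^sup>+u. ennreal ((norm (u - m i))\<^sup>2) \<partial>P i) = ennreal (v i)"
    and v: "\<And>i. i \<in> I \<Longrightarrow> v i \<ge> 0"
  shows "(\<integral>\<^sup>+y. ennreal ((norm (e + (\<Sum>i\<in>S. c i *\<^sub>R (y i - m i))))\<^sup>2) \<partial>PiM I P)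
    = ennreal ((norm e)\<^sup>2 + (\<Sum>i\<in>S. (c i)\<^sup>2 * v i))"
proof -
  \<comment> \<open>Point masses outside \<open>I\<close> make the family one of probability
    measures at every index, as \<open>product_prob_space\<close> demands.\<close>
  define N where "N i = (if i \<in> I then P i else return borel 0)" for i
  have N: "prob_space (N i)" "sets (N i) = sets borel" for i
    using P by (auto simp: N_def space_prob_algebra prob_space_return)
  note [measurable_cong] = N(2)
  interpret N: product_prob_space N
    by (intro product_prob_spaceI N)
  have PN: "PiM I P = PiM I N" by (rule PiM_cong) (auto simp: N_def)
  define R where "R = PiM I N"
  interpret R: prob_space R unfolding R_def by (rule prob_space_PiM) (rule N)
  have comp[measurable]: "(\<lambda>y. y i) \<in> R \<rightarrow>\<^sub>M borel" if "i \<in> I" for i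
  proof -
    have "(\<lambda>y. y i) \<in> R \<rightarrow>\<^sub>M N i" unfolding R_def using that by measurable
    then show ?thesis by (simp add: measurable_cong_sets[OF refl N(2)])
  qed
  have dist: "distr R borel (\<lambda>y. y i) = N i" if "i \<in> I" for i
  proof -
    have "distr R borel (\<lambda>y. y i) = distr R (N i) (\<lambda>y. y i)"
      by (rule distr_cong) (auto simp: N(2))
    also have "\<dots> = N i" unfolding R_def using N(1) that by (rule distr_PiM_component)
    finally show ?thesis .
  qed
  have Xint: "integrable R (\<lambda>y. y i - m i)" "(\<integral>y. y i - m i \<partial>R) = 0" if i: "i \<in> I" for i
  proof -
    have "integrable (distr R borel (\<lambda>y. y i)) (\<lambda>u. u)" "(\<integral>u. u \<partial>distr R borel (\<lambda>y. y i)) = m i"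
      using int[OF i] mean[OF i] i by (auto simp: dist N_def)
    then have "integrable R (\<lambda>y. y i)" "(\<integral>y. y i \<partial>R) = m i"
      using i by (auto simp: integrable_distr_eq integral_distr)
    then show "integrable R (\<lambda>y. y i - m i)" "(\<integral>y. y i - m i \<partial>R) = 0"
      by (auto simp: R.prob_space)
  qed
  have Xsq: "integrable R (\<lambda>y. (norm (y i - m i))\<^sup>2)" "(\<integral>y. (norm (y i - m i))\<^sup>2 \<partial>R) = v i"
    if i: "i \<in> I" for i
  proof -
    have "(\<integral>\<^sup>+y. ennreal ((norm (y i - m i))\<^sup>2) \<partial>R)
        = (\<integral>\<^sup>+u. ennreal ((norm (u - m i))\<^sup>2) \<partial>distr R borel (\<lambda>y. y i))"
      using i by (subst nn_integral_distr) auto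
    also have "\<dots> = ennreal (v i)" using var[OF i] i by (simp add: dist N_def)
    finally have nn: "(\<integral>\<^sup>+y. ennreal ((norm (y i - m i))\<^sup>2) \<partial>R) = ennreal (v i)" .
    have meas: "(\<lambda>y. (norm (y i - m i))\<^sup>2) \<in> borel_measurable R" using i by measurable
    show "integrable R (\<lambda>y. (norm (y i - m i))\<^sup>2)"
      by (rule integrableI_nonneg[OF meas]) (auto simp: nn)
    show "(\<integral>y. (norm (y i - m i))\<^sup>2 \<partial>R) = v i"
      by (subst integral_eq_nn_integral[OF meas]) (auto simp: nn v i)
  qed
  have cross: "integrable R (\<lambda>y. (y i - m i) \<bullet> (y l - m l))" "(\<integral>y. (y i - m i) \<bullet> (y l - m l) \<partial>R) = 0"
    if i: "i \<in> I" and l: "l \<in> I" and il: "i \<noteq> l" for i l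
  proof -
    \<comment> \<open>The inner product is treated coordinate by coordinate, where it becomes a
      product of real functions of two independent components.\<close>
    have coord: "integrable R (\<lambda>y. ((y i - m i) \<bullet> b) * ((y l - m l) \<bullet> b))"
      "(\<integral>y. ((y i - m i) \<bullet> b) * ((y l - m l) \<bullet> b) \<partial>R) = 0" for b
    proof -
      \<comment> \<open>Factors equal to 1 away from \<open>i\<close> and \<open>l\<close> extend
        the product of two functions to a product over all of \<open>I\<close>. Its integral
        factorizes, and the factor at \<open>i\<close> vanishes.\<close>
      define h where "h j = (if j = i \<or> j = l then (\<lambda>u. (u - m j) \<bullet> b) else (\<lambda>u. 1))" for j
      have h: "integrable (N j) (h j)" if "j \<in> I" for j
      proof -
        have "integrable (N j) (\<lambda>u. u)" using int that by (simp add: N_def)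
        then show ?thesis by (simp add: h_def)
      qed
      have hi: "(\<integral>u. h i u \<partial>N i) = 0"
      proof -
        have "integrable (N i) (\<lambda>u. u)" "(\<integral>u. u \<partial>N i) = m i"
          using int i mean by (auto simp: N_def)
        then show ?thesis by (simp add: h_def N.M.prob_space inner_diff_left)
      qed
      have eq: "(\<Prod>j\<in>I. h j (y j)) = ((y i - m i) \<bullet> b) * ((y l - m l) \<bullet> b)" for y
      proof -
        have "(\<Prod>j\<in>I. h j (y j)) = (\<Prod>j\<in>{i, l}. h j (y j))"
          using I i l by (intro prod.mono_neutral_right) (auto simp: h_def)
        then show ?thesis using il by (simp add: h_def)
      qed
      show "integrable R (\<lambda>y. ((y i - m i) \<bullet> b) * ((y l - m l) \<bullet> b))"
        using N.product_integrable_prod[OF I h] by (simp add: eq R_def)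
      have "(\<integral>y. ((y i - m i) \<bullet> b) * ((y l - m l) \<bullet> b) \<partial>R) = (\<Prod>j\<in>I. \<integral>u. h j u \<partial>N j)"
        using N.product_integral_prod[OF I h] by (simp add: eq R_def)
      also have "\<dots> = 0" using I i hi by (intro prod_zero) auto
      finally show "(\<integral>y. ((y i - m i) \<bullet> b) * ((y l - m l) \<bullet> b) \<partial>R) = 0" .
    qed
    have inner_eq: "(\<lambda>y. (y i - m i) \<bullet> (y l - m l))
        = (\<lambda>y. \<Sum>b\<in>Basis. ((y i - m i) \<bullet> b) * ((y l - m l) \<bullet> b))"
      by (rule ext) (rule euclidean_inner)
    show "integrable R (\<lambda>y. (y i - m i) \<bullet> (y l - m l))"
      unfolding inner_eq by (rule Bochner_Integration.integrable_sum) (rule coord)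
    have "(\<integral>y. (\<Sum>b\<in>Basis. ((y i - m i) \<bullet> b) * ((y l - m l) \<bullet> b)) \<partial>R)
        = (\<Sum>b\<in>Basis. \<integral>y. ((y i - m i) \<bullet> b) * ((y l - m l) \<bullet> b) \<partial>R)"
      by (rule Bochner_Integration.integral_sum) (rule coord)
    then show "(\<integral>y. (y i - m i) \<bullet> (y l - m l) \<partial>R) = 0"
      unfolding inner_eq by (simp only: coord sum.neutral_const)
  qed
  have inner_int: "integrable R (\<lambda>y. (y i - m i) \<bullet> (y l - m l))"
    and inner_val: "(\<integral>y. (y i - m i) \<bullet> (y l - m l) \<partial>R) = (if i = l then v i else 0)"
    if "i \<in> I" "l \<in> I" for i l
    using cross[OF that] Xsq[OF that(1)] by (cases "i = l"; simp add: power2_norm_eq_inner)+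
  have S': "finite S" "\<And>i. i \<in> S \<Longrightarrow> i \<in> I" using S I finite_subset by auto
  have expand: "(\<lambda>y. (norm (e + (\<Sum>i\<in>S. c i *\<^sub>R (y i - m i))))\<^sup>2)
      = (\<lambda>y. (norm e)\<^sup>2 + (\<Sum>i\<in>S. 2 * c i * (e \<bullet> (y i - m i)))
        + (\<Sum>i\<in>S. \<Sum>l\<in>S. c i * c l * ((y i - m i) \<bullet> (y l - m l))))"
    unfolding power2_norm_eq_inner
    by (simp add: fun_eq_iff inner_add_left inner_add_right inner_sum_left inner_sum_right
        inner_commute sum_distrib_left mult_ac sum.distrib[symmetric])
  have lin: "integrable R (\<lambda>y. e \<bullet> (y i - m i))" "(\<integral>y. e \<bullet> (y i - m i) \<partial>R) = 0" if "i \<in> I" for i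
    using Xint[OF that] integral_inner_right[of e R "\<lambda>y. y i - m i"] by (auto simp del: integral_inner_right)
  have "(\<integral>\<^sup>+y. ennreal ((norm (e + (\<Sum>i\<in>S. c i *\<^sub>R (y i - m i))))\<^sup>2) \<partial>R)
    = ennreal (\<integral>y. (norm (e + (\<Sum>i\<in>S. c i *\<^sub>R (y i - m i))))\<^sup>2 \<partial>R)"
  proof (rule nn_integral_eq_integral)
    show "integrable R (\<lambda>y. (norm (e + (\<Sum>i\<in>S. c i *\<^sub>R (y i - m i))))\<^sup>2)"
      unfolding expand using S' lin(1) inner_int by (intro Bochner_Integration.integrable_add
        Bochner_Integration.integrable_sum integrable_mult_right) auto
  qed simp
  also have "(\<integral>y. (norm (e + (\<Sum>i\<in>S. c i *\<^sub>R (y i - m i))))\<^sup>2 \<partial>R)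
      = (norm e)\<^sup>2 + (\<Sum>i\<in>S. 2 * c i * 0) + (\<Sum>i\<in>S. \<Sum>l\<in>S. c i * c l * (if i = l then v i else 0))"
    unfolding expand using S' lin inner_int
    by (simp add: Bochner_Integration.integral_sum inner_val R.prob_space)
  also have "(\<Sum>i\<in>S. \<Sum>l\<in>S. c i * c l * (if i = l then v i else 0)) = (\<Sum>i\<in>S. (c i)\<^sup>2 * v i)"
    using S' by (simp add: power2_eq_square if_distrib cong: if_cong)
  finally show ?thesis by (simp add: PN R_def)
qed

section \<open>Markov kernels and integration against fresh randomness\<close>

lemma measurable_PiM_prob_algebra:
  fixes \<kappa> :: "'i \<Rightarrow> 't \<Rightarrow> 'v measure"
  assumes I: "finite I" and \<kappa>: "\<And>i. i \<in> I \<Longrightarrow> \<kappa> i \<in> X \<rightarrow>\<^sub>M prob_algebra (Z i)"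
  shows "(\<lambda>t. PiM I (\<lambda>i. \<kappa> i t)) \<in> X \<rightarrow>\<^sub>M prob_algebra (PiM I Z)"
\<comment> \<open>Boxes form an intersection-stable generator of the product sigma-algebra, and on a
  box the product measure is a finite product of measurable functions of the parameter.\<close>
proof (rule measurable_prob_algebra_generated[OF sets_PiM Int_stable_prod_algebra prod_algebra_sets_into_space])
  fix t assume t: "t \<in> space X"
  have \<kappa>t: "prob_space (\<kappa> i t)" "sets (\<kappa> i t) = sets (Z i)" if "i \<in> I" for i
    using measurable_space[OF \<kappa>[OF that] t] by (auto simp: space_prob_algebra)
  show "prob_space (PiM I (\<lambda>i. \<kappa> i t))" by (rule prob_space_PiM) (rule \<kappa>t)
  show "sets (PiM I (\<lambda>i. \<kappa> i t)) = sets (PiM I Z)" by (rule sets_PiM_cong) (auto simp: \<kappa>t)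
next
  fix A assume "A \<in> prod_algebra I Z"
  then obtain E where A: "A = Pi\<^sub>E I E" and E: "\<And>i. i \<in> I \<Longrightarrow> E i \<in> sets (Z i)"
    by (elim prod_algebraE_all) auto
  have "emeasure (PiM I (\<lambda>i. \<kappa> i t)) A = (\<Prod>i\<in>I. emeasure (\<kappa> i t) (E i))" if t: "t \<in> space X" for t
  proof -
    have \<kappa>t: "prob_space (\<kappa> i t)" "sets (\<kappa> i t) = sets (Z i)" if "i \<in> I" for i
      using measurable_space[OF \<kappa>[OF that] t] by (auto simp: space_prob_algebra)
    have "A = prod_emb I (\<lambda>i. \<kappa> i t) I (Pi\<^sub>E I E)"
      unfolding A
      by (rule prod_emb_PiE_same_index[symmetric]) (metis E \<kappa>t(2) sets.sets_into_space)
    then show ?thesis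
      using I E \<kappa>t by (simp add: emeasure_PiM_emb)
  qed
  moreover have "(\<lambda>t. \<Prod>i\<in>I. emeasure (\<kappa> i t) (E i)) \<in> borel_measurable X"
    using E \<kappa> by (intro borel_measurable_prod_ennreal measurable_compose[OF _ measurable_emeasure_subprob_algebra])
      (auto intro: measurable_prob_algebraD)
  ultimately show "(\<lambda>t. emeasure (PiM I (\<lambda>i. \<kappa> i t)) A) \<in> borel_measurable X"
    by (simp cong: measurable_cong)
qed

text \<open>The conditional law of \<open>Y\<close> is given on rectangles only. These form an
  intersection-stable generator, so the joint law of \<open>T\<close> and \<open>Y\<close> is
  determined and any nonnegative \<open>h\<close> can be integrated against it. \<open>N\<close> is
  a finite measure rather than a probability because it will be \<open>M\<close> restricted to one
  coin outcome.\<close>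

lemma nn_integral_disintegration:
  assumes "finite_measure N"
    and T[measurable]: "T \<in> N \<rightarrow>\<^sub>M X" and Y[measurable]: "Y \<in> N \<rightarrow>\<^sub>M Z"
    and \<kappa>[measurable]: "\<kappa> \<in> X \<rightarrow>\<^sub>M subprob_algebra Z"
    and law: "\<And>A S. A \<in> sets X \<Longrightarrow> S \<in> sets Z \<Longrightarrow>
      emeasure N {\<omega>\<in>space N. T \<omega> \<in> A \<and> Y \<omega> \<in> S} = (\<integral>\<^sup>+\<omega>. indicator A (T \<omega>) * emeasure (\<kappa> (T \<omega>)) S \<partial>N)"
    and h[measurable]: "h \<in> borel_measurable (X \<Otimes>\<^sub>M Z)"
  shows "(\<integral>\<^sup>+\<omega>. h (T \<omega>, Y \<omega>) \<partial>N) = (\<integral>\<^sup>+\<omega>. \<integral>\<^sup>+y. h (T \<omega>, y) \<partial>\<kappa> (T \<omega>) \<partial>N)"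
\<comment> \<open>Over an empty space \<open>bind\<close> takes a default value, so this case is set
  apart.\<close>
proof (cases "space N = {}")
  case True
  then show ?thesis by (simp add: nn_integral_empty)
next
  case False
  interpret finite_measure N by fact
  \<comment> \<open>Pairing \<open>T \<omega>\<close> with a draw from its kernel makes
    \<open>bind N k\<close> the candidate for the joint law; \<open>law\<close> enters when the two
    are compared on rectangles.\<close>
  define k where "k \<omega> = distr (\<kappa> (T \<omega>)) (X \<Otimes>\<^sub>M Z) (\<lambda>y. (T \<omega>, y))" for \<omega>
  have k[measurable]: "k \<in> N \<rightarrow>\<^sub>M subprob_algebra (X \<Otimes>\<^sub>M Z)"
    unfolding k_def by (rule measurable_distr2[where M = Z]) measurable
  have sk: "sets (\<kappa> (T \<omega>)) = sets Z" if "\<omega> \<in> space N" for \<omega>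
    using measurable_space[OF \<kappa> measurable_space[OF T that]] by (simp add: space_subprob_algebra)
  have Tin: "T \<omega> \<in> space X" if "\<omega> \<in> space N" for \<omega> using measurable_space[OF T that] .
  let ?E = "{a \<times> b |a b. a \<in> sets X \<and> b \<in> sets Z}"
  have "distr N (X \<Otimes>\<^sub>M Z) (\<lambda>\<omega>. (T \<omega>, Y \<omega>)) = bind N k"
  proof (rule measure_eqI_generator_eq[OF Int_stable_pair_measure_generator pair_measure_closed])
    show "sets (distr N (X \<Otimes>\<^sub>M Z) (\<lambda>\<omega>. (T \<omega>, Y \<omega>))) = sigma_sets (space X \<times> space Z) ?E"
      by (simp add: sets_pair_measure)
    show "sets (bind N k) = sigma_sets (space X \<times> space Z) ?E"
      using False by (simp add: sets_pair_measure[symmetric] sets_bind[where N = "X \<Otimes>\<^sub>M Z"] k_def)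
    show "range (\<lambda>_::nat. space X \<times> space Z) \<subseteq> ?E" by auto
    show "emeasure (distr N (X \<Otimes>\<^sub>M Z) (\<lambda>\<omega>. (T \<omega>, Y \<omega>))) (space X \<times> space Z) \<noteq> \<infinity>"
      by (subst emeasure_distr) (auto intro!: measurable_Pair)
    fix G assume "G \<in> ?E"
    then obtain A S where G: "G = A \<times> S" and A[measurable]: "A \<in> sets X" and S[measurable]: "S \<in> sets Z" by auto
    have "emeasure (distr N (X \<Otimes>\<^sub>M Z) (\<lambda>\<omega>. (T \<omega>, Y \<omega>))) G
        = emeasure N {\<omega>\<in>space N. T \<omega> \<in> A \<and> Y \<omega> \<in> S}"
      by (subst emeasure_distr) (auto simp: G intro!: arg_cong[where f = "emeasure N"])
    also have "\<dots> = (\<integral>\<^sup>+\<omega>. emeasure (k \<omega>) G \<partial>N)"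
      unfolding law[OF A S]
    proof (rule nn_integral_cong)
      fix \<omega> assume \<omega>: "\<omega> \<in> space N"
      note [measurable_cong] = sk[OF \<omega>]
      have "emeasure (k \<omega>) G = emeasure (\<kappa> (T \<omega>)) ((\<lambda>y. (T \<omega>, y)) -` G \<inter> space (\<kappa> (T \<omega>)))"
        unfolding k_def by (rule emeasure_distr) (use Tin[OF \<omega>] in \<open>auto simp: G\<close>)
      also have "(\<lambda>y. (T \<omega>, y)) -` G \<inter> space (\<kappa> (T \<omega>)) = (if T \<omega> \<in> A then S else {})"
        using sets.sets_into_space[OF S] sets_eq_imp_space_eq[OF sk[OF \<omega>]] by (auto simp: G)
      finally show "indicator A (T \<omega>) * emeasure (\<kappa> (T \<omega>)) S = emeasure (k \<omega>) G"
        by simp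
    qed
    also have "\<dots> = emeasure (bind N k) G"
      by (rule emeasure_bind[OF False k, symmetric]) (simp add: G)
    finally show "emeasure (distr N (X \<Otimes>\<^sub>M Z) (\<lambda>\<omega>. (T \<omega>, Y \<omega>))) G = emeasure (bind N k) G" .
  qed auto
  then have "(\<integral>\<^sup>+z. h z \<partial>distr N (X \<Otimes>\<^sub>M Z) (\<lambda>\<omega>. (T \<omega>, Y \<omega>))) = (\<integral>\<^sup>+z. h z \<partial>bind N k)"
    by simp
  also have "(\<integral>\<^sup>+z. h z \<partial>bind N k) = (\<integral>\<^sup>+\<omega>. \<integral>\<^sup>+z. h z \<partial>k \<omega> \<partial>N)"
    by (rule nn_integral_bind[OF h k])
  also have "\<dots> = (\<integral>\<^sup>+\<omega>. \<integral>\<^sup>+y. h (T \<omega>, y) \<partial>\<kappa> (T \<omega>) \<partial>N)"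
  proof (rule nn_integral_cong)
    fix \<omega> assume \<omega>: "\<omega> \<in> space N"
    have "(\<lambda>y. (T \<omega>, y)) \<in> \<kappa> (T \<omega>) \<rightarrow>\<^sub>M X \<Otimes>\<^sub>M Z"
      using measurable_Pair1'[OF Tin[OF \<omega>]] by (simp add: measurable_cong_sets[OF sk[OF \<omega>] refl])
    then show "(\<integral>\<^sup>+z. h z \<partial>k \<omega>) = (\<integral>\<^sup>+y. h (T \<omega>, y) \<partial>\<kappa> (T \<omega>))"
      unfolding k_def by (rule nn_integral_distr) (use h in simp)
  qed
  finally show ?thesis by (subst (asm) nn_integral_distr) auto
qed

text \<open>Restricted to \<open>F\<close>, the measure with density \<open>indicator C\<close> is
  \<open>M\<close> scaled by \<open>r\<close>, and the integral of an \<open>F\<close>-measurable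
  function depends on that restriction alone.\<close>

lemma nn_integral_indicator_indep:
  assumes "finite_measure M" and sub: "subalgebra M F" and C[measurable]: "C \<in> sets M"
    and indep: "\<And>A. A \<in> sets F \<Longrightarrow> emeasure M (A \<inter> C) = r * emeasure M A"
    and u: "u \<in> borel_measurable F"
  shows "(\<integral>\<^sup>+\<omega>. indicator C \<omega> * u \<omega> \<partial>M) = r * (\<integral>\<^sup>+\<omega>. u \<omega> \<partial>M)"
proof -
  let ?D = "density M (indicator C)"
  have subD: "subalgebra ?D F" using sub by (simp add: subalgebra_def)
  have uM[measurable]: "u \<in> borel_measurable M" by (rule measurable_from_subalg[OF sub u])
  have eq: "restr_to_subalg ?D F = scale_measure r (restr_to_subalg M F)"
  proof (rule measure_eqI)
    show "sets (restr_to_subalg ?D F) = sets (scale_measure r (restr_to_subalg M F))"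
      by (simp add: sets_restr_to_subalg[OF sub] sets_restr_to_subalg[OF subD])
    fix A assume "A \<in> sets (restr_to_subalg ?D F)"
    then have A: "A \<in> sets F" by (simp add: sets_restr_to_subalg[OF subD])
    then have [measurable]: "A \<in> sets M" using sub by (auto simp: subalgebra_def)
    show "emeasure (restr_to_subalg ?D F) A = emeasure (scale_measure r (restr_to_subalg M F)) A"
      using indep[OF A] by (simp add: emeasure_restr_to_subalg[OF sub A] emeasure_restr_to_subalg[OF subD A]
          emeasure_density indicator_inter_arith[symmetric] Int_commute)
  qed
  have "(\<integral>\<^sup>+\<omega>. indicator C \<omega> * u \<omega> \<partial>M) = (\<integral>\<^sup>+\<omega>. u \<omega> \<partial>?D)"
    by (simp add: nn_integral_density)
  also have "\<dots> = (\<integral>\<^sup>+\<omega>. u \<omega> \<partial>scale_measure r (restr_to_subalg M F))"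
    by (simp add: nn_integral_subalgebra2[OF subD u, symmetric] eq)
  also have "\<dots> = r * (\<integral>\<^sup>+\<omega>. u \<omega> \<partial>M)"
    using u by (simp add: nn_integral_scale_measure measurable_in_subalg[OF sub] nn_integral_subalgebra2[OF sub])
  finally show ?thesis .
qed

subsection \<open>One step of Byz-VR-MARINA\<close>

text \<open>This takes the place of conditioning on the past and on the coin. On \<open>C\<close>
  the sample is integrated out against its kernel; what remains is a function of \<open>T\<close>,
  hence of the past, and the coin event contributes only the factor \<open>r\<close>.\<close>

lemma nn_integral_fresh_sample:
  fixes M :: "'w measure" and r :: real
  assumes "prob_space M" and sub: "subalgebra M F" and C[measurable]: "C \<in> sets M" and r: "r \<ge> 0"
    and indep: "\<And>A. A \<in> sets F \<Longrightarrow> measure M (A \<inter> C) = r * measure M A"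
    and T: "T \<in> F \<rightarrow>\<^sub>M X" and Y[measurable]: "Y \<in> M \<rightarrow>\<^sub>M Z"
    and \<kappa>: "\<kappa> \<in> X \<rightarrow>\<^sub>M prob_algebra Z"
    and law: "\<And>A S. A \<in> sets F \<Longrightarrow> S \<in> sets Z \<Longrightarrow>
      measure M (A \<inter> C \<inter> {\<omega>\<in>space M. Y \<omega> \<in> S}) = (\<integral>\<omega>\<in>(A \<inter> C). measure (\<kappa> (T \<omega>)) S \<partial>M)"
    and h[measurable]: "h \<in> borel_measurable (X \<Otimes>\<^sub>M Z)"
  shows "(\<integral>\<^sup>+\<omega>. indicator C \<omega> * h (T \<omega>, Y \<omega>) \<partial>M)
    = ennreal r * (\<integral>\<^sup>+\<omega>. \<integral>\<^sup>+y. h (T \<omega>, y) \<partial>\<kappa> (T \<omega>) \<partial>M)"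
proof -
  interpret prob_space M by fact
  have TM[measurable]: "T \<in> M \<rightarrow>\<^sub>M X" by (rule measurable_from_subalg[OF sub T])
  have spF: "space F = space M" using sub by (simp add: subalgebra_def)
  note \<kappa>s[measurable] = measurable_prob_algebraD[OF \<kappa>]
  let ?N = "density M (indicator C)"
  have pk: "prob_space (\<kappa> (T \<omega>))" if "\<omega> \<in> space M" for \<omega>
    using measurable_space[OF \<kappa> measurable_space[OF TM that]] by (simp add: space_prob_algebra)
  have H: "(\<lambda>t. \<integral>\<^sup>+y. h (t, y) \<partial>\<kappa> t) \<in> borel_measurable X"
    by (rule nn_integral_measurable_subprob_algebra2[OF _ \<kappa>s]) simp
  \<comment> \<open>The disintegration is applied under \<open>M\<close> restricted to
    \<open>C\<close>. Preimages under \<open>T\<close> are events of the past, so \<open>law\<close>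
    covers the required rectangles.\<close>
  have "(\<integral>\<^sup>+\<omega>. h (T \<omega>, Y \<omega>) \<partial>?N) = (\<integral>\<^sup>+\<omega>. \<integral>\<^sup>+y. h (T \<omega>, y) \<partial>\<kappa> (T \<omega>) \<partial>?N)"
  proof (rule nn_integral_disintegration[where X = X and Z = Z])
    show "finite_measure ?N"
      by (rule finite_measureI) (simp add: emeasure_density)
    fix A S assume A[measurable]: "A \<in> sets X" and S[measurable]: "S \<in> sets Z"
    let ?A = "T -` A \<inter> space M"
    have AF: "?A \<in> sets F" using measurable_sets[OF T A] by (simp add: spF)
    have "emeasure ?N {\<omega>\<in>space ?N. T \<omega> \<in> A \<and> Y \<omega> \<in> S} = emeasure M (?A \<inter> C \<inter> {\<omega>\<in>space M. Y \<omega> \<in> S})"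
      by (simp add: emeasure_density)
         (auto simp flip: nn_integral_indicator intro!: nn_integral_cong split: split_indicator)
    also have "\<dots> = ennreal (\<integral>\<omega>. indicator (?A \<inter> C) \<omega> * measure (\<kappa> (T \<omega>)) S \<partial>M)"
      using law[OF AF S] by (simp add: emeasure_eq_measure set_lebesgue_integral_def)
    also have "\<dots> = (\<integral>\<^sup>+\<omega>. ennreal (indicator (?A \<inter> C) \<omega> * measure (\<kappa> (T \<omega>)) S) \<partial>M)"
    proof (rule nn_integral_eq_integral[symmetric])
      show "integrable M (\<lambda>\<omega>. indicator (?A \<inter> C) \<omega> * measure (\<kappa> (T \<omega>)) S)"
      proof (rule integrable_const_bound[where B = 1])
        show "AE \<omega> in M. norm (indicator (?A \<inter> C) \<omega> * measure (\<kappa> (T \<omega>)) S) \<le> 1"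
          using pk by (auto intro!: AE_I2 prob_space.prob_le_1 split: split_indicator)
      qed measurable
    qed simp
    also have "\<dots> = (\<integral>\<^sup>+\<omega>. indicator C \<omega> * (indicator A (T \<omega>) * emeasure (\<kappa> (T \<omega>)) S) \<partial>M)"
      using pk prob_space.finite_measure finite_measure.emeasure_eq_measure
      by (intro nn_integral_cong) (fastforce split: split_indicator)
    finally show "emeasure ?N {\<omega>\<in>space ?N. T \<omega> \<in> A \<and> Y \<omega> \<in> S}
        = (\<integral>\<^sup>+\<omega>. indicator A (T \<omega>) * emeasure (\<kappa> (T \<omega>)) S \<partial>?N)"
      by (simp add: nn_integral_density)
  qed simp_all
  then have "(\<integral>\<^sup>+\<omega>. indicator C \<omega> * h (T \<omega>, Y \<omega>) \<partial>M)
      = (\<integral>\<^sup>+\<omega>. indicator C \<omega> * (\<integral>\<^sup>+y. h (T \<omega>, y) \<partial>\<kappa> (T \<omega>)) \<partial>M)"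
    using measurable_compose[OF TM H] by (simp add: nn_integral_density)
  also have "\<dots> = ennreal r * (\<integral>\<^sup>+\<omega>. \<integral>\<^sup>+y. h (T \<omega>, y) \<partial>\<kappa> (T \<omega>) \<partial>M)"
    by (rule nn_integral_indicator_indep[OF _ sub C _ measurable_compose[OF T H]])
      (use r in \<open>auto simp: emeasure_eq_measure indep ennreal_mult finite_measure_axioms\<close>)
  finally show ?thesis .
qed

lemma sum_nn_integral_PiM_norm_diff_sq:
  fixes P :: "'i \<Rightarrow> 'v::euclidean_space measure" and v :: "'i \<Rightarrow> real"
  assumes I: "finite I" and ne: "I \<noteq> {}"
    and P: "\<And>i. i \<in> I \<Longrightarrow> P i \<in> space (prob_algebra borel)"
    and int: "\<And>i. i \<in> I \<Longrightarrow> integrable (P i) (\<lambda>u. u)"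
    and mean: "\<And>i. i \<in> I \<Longrightarrow> (\<integral>u. u \<partial>P i) = m i"
    and var: "\<And>i. i \<in> I \<Longrightarrow> (\<integral>\<^sup>+u. ennreal ((norm (u - m i))\<^sup>2) \<partial>P i) = ennreal (v i)"
    and v: "\<And>i. i \<in> I \<Longrightarrow> v i \<ge> 0"
  shows "(\<Sum>i\<in>I. \<Sum>l\<in>I. \<integral>\<^sup>+y. ennreal ((norm (y i - y l))\<^sup>2) \<partial>PiM I P)
    = ennreal (2 * (real (card I) - 1) * (\<Sum>i\<in>I. v i) + (\<Sum>i\<in>I. \<Sum>l\<in>I. (norm (m i - m l))\<^sup>2))"
proof -
  have one: "(\<integral>\<^sup>+y. ennreal ((norm (y i - y l))\<^sup>2) \<partial>PiM I P)
      = ennreal ((if i = l then 0 else v i + v l) + (norm (m i - m l))\<^sup>2)" if i: "i \<in> I" and l: "l \<in> I" for i l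
  proof (cases "i = l")
    case False
    define c where "c j = (if j = i then 1 else - 1 :: real)" for j
    have "(\<integral>\<^sup>+y. ennreal ((norm (y i - y l))\<^sup>2) \<partial>PiM I P)
        = (\<integral>\<^sup>+y. ennreal ((norm ((m i - m l) + (\<Sum>j\<in>{i, l}. c j *\<^sub>R (y j - m j))))\<^sup>2) \<partial>PiM I P)"
      using False by (simp add: c_def)
    also have "\<dots> = ennreal ((norm (m i - m l))\<^sup>2 + (\<Sum>j\<in>{i, l}. (c j)\<^sup>2 * v j))"
      by (rule nn_integral_PiM_norm_sq[OF I _ P int mean var v]) (use i l in auto)
    also have "(\<Sum>j\<in>{i, l}. (c j)\<^sup>2 * v j) = v i + v l"
      using False by (simp add: c_def)
    finally show ?thesis using False by (simp add: add.commute)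
  qed simp
  have "(\<Sum>i\<in>I. \<Sum>l\<in>I. \<integral>\<^sup>+y. ennreal ((norm (y i - y l))\<^sup>2) \<partial>PiM I P)
      = (\<Sum>i\<in>I. \<Sum>l\<in>I. ennreal ((if i = l then 0 else v i + v l) + (norm (m i - m l))\<^sup>2))"
    by (intro sum.cong refl one)
  also have "\<dots> = ennreal (\<Sum>i\<in>I. \<Sum>l\<in>I. (if i = l then 0 else v i + v l) + (norm (m i - m l))\<^sup>2)"
    using v by (simp add: sum_ennreal sum_nonneg del: ennreal_plus)
  also have "(\<Sum>i\<in>I. \<Sum>l\<in>I. (if i = l then 0 else v i + v l) + (norm (m i - m l))\<^sup>2)
      = (\<Sum>i\<in>I. \<Sum>l\<in>I. (if i = l then 0 else v i + v l)) + (\<Sum>i\<in>I. \<Sum>l\<in>I. (norm (m i - m l))\<^sup>2)"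
    by (simp add: sum.distrib)
  \<comment> \<open>Summing over all pairs and removing the diagonal counts each \<open>v i\<close>
    exactly \<open>2 * (card I - 1)\<close> times.\<close>
  also have "(\<Sum>i\<in>I. \<Sum>l\<in>I. (if i = l then 0 else v i + v l))
      = (\<Sum>i\<in>I. \<Sum>l\<in>I. (v i + v l) - (if i = l then 2 * v i else 0))"
    by (intro sum.cong) auto
  also have "\<dots> = 2 * (real (card I) - 1) * (\<Sum>i\<in>I. v i)"
    using I by (simp add: sum.distrib sum_subtractf sum_distrib_left[symmetric] left_diff_distrib)
  finally show ?thesis .
qed

text \<open>Only the average of the variances is bounded, but a finite sum in \<open>ennreal\<close>
  that lies below a real number has finite terms. The individual variances can therefore be named as
  reals, although they have no bound of their own in the hypotheses.\<close>

lemma compressed_estimator_variances: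
  fixes D :: "'i \<Rightarrow> 'v::euclidean_space measure" and s om :: real
  assumes I: "finite I" and ne: "I \<noteq> {}"
    and D: "\<And>i. i \<in> I \<Longrightarrow> D i \<in> space (prob_algebra borel)"
    and D_int: "\<And>i. i \<in> I \<Longrightarrow> integrable (D i) (\<lambda>v. v)"
    and D_mean: "\<And>i. i \<in> I \<Longrightarrow> (\<integral>v. v \<partial>D i) = m i"
    and D_var: "ennreal (1 / real (card I)) *
        (\<Sum>i\<in>I. \<integral>\<^sup>+v. ennreal ((norm (v - m i))\<^sup>2) \<partial>D i) \<le> ennreal s" and s: "s \<ge> 0"
    and Q: "Q \<in> borel \<rightarrow>\<^sub>M prob_algebra borel"
    and Q_int: "\<And>v. integrable (Q v) (\<lambda>u. u)" and Q_mean: "\<And>v. (\<integral>u. u \<partial>Q v) = v"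
    and Q_var: "\<And>v. (\<integral>\<^sup>+u. ennreal ((norm (u - v))\<^sup>2) \<partial>Q v) \<le> ennreal (om * (norm v)\<^sup>2)"
    and om: "om \<ge> 0"
  obtains v :: "'i \<Rightarrow> real" where
    "\<And>i. i \<in> I \<Longrightarrow> bind (D i) Q \<in> space (prob_algebra borel)"
    "\<And>i. i \<in> I \<Longrightarrow> integrable (bind (D i) Q) (\<lambda>u. u)"
    "\<And>i. i \<in> I \<Longrightarrow> (\<integral>u. u \<partial>bind (D i) Q) = m i"
    "\<And>i. i \<in> I \<Longrightarrow> (\<integral>\<^sup>+u. ennreal ((norm (u - m i))\<^sup>2) \<partial>bind (D i) Q) = ennreal (v i)"
    "\<And>i. i \<in> I \<Longrightarrow> v i \<ge> 0"
    "(\<Sum>i\<in>I. v i) \<le> card I * ((1 + om) * s) + om * (\<Sum>i\<in>I. (norm (m i))\<^sup>2)"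
proof -
  define w where "w i = enn2real (\<integral>\<^sup>+v. ennreal ((norm (v - m i))\<^sup>2) \<partial>D i)" for i
  define v where "v i = enn2real (\<integral>\<^sup>+u. ennreal ((norm (u - m i))\<^sup>2) \<partial>bind (D i) Q)" for i
  have c: "real (card I) > 0" using I ne by (simp add: card_gt_0_iff)
  have "(\<Sum>i\<in>I. \<integral>\<^sup>+v. ennreal ((norm (v - m i))\<^sup>2) \<partial>D i)
      = ennreal (real (card I)) * (ennreal (1 / real (card I)) * (\<Sum>i\<in>I. \<integral>\<^sup>+v. ennreal ((norm (v - m i))\<^sup>2) \<partial>D i))"
    using c by (simp add: mult.assoc[symmetric] ennreal_mult[symmetric])
  also have "\<dots> \<le> ennreal (card I) * ennreal s"
    by (rule mult_left_mono[OF D_var]) simp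
  finally have sum: "(\<Sum>i\<in>I. \<integral>\<^sup>+v. ennreal ((norm (v - m i))\<^sup>2) \<partial>D i) \<le> ennreal (card I * s)"
    using s by (simp add: ennreal_mult)
  then have "(\<Sum>i\<in>I. \<integral>\<^sup>+v. ennreal ((norm (v - m i))\<^sup>2) \<partial>D i) < \<infinity>"
    by (rule le_less_trans) simp
  then have w: "(\<integral>\<^sup>+v. ennreal ((norm (v - m i))\<^sup>2) \<partial>D i) = ennreal (w i)" if "i \<in> I" for i
    using I that by (simp add: w_def less_top[symmetric] ennreal_enn2real_if)
  have w0: "w i \<ge> 0" for i by (simp add: w_def)
  have sumw: "(\<Sum>i\<in>I. w i) \<le> card I * s"
  proof -
    have "ennreal (\<Sum>i\<in>I. w i) \<le> ennreal (card I * s)"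
      using sum by (simp add: w w0 cong: sum.cong)
    then show ?thesis using s by (simp add: ennreal_le_iff)
  qed
  note b = bind_unbiased_compressor[OF D Q Q_int Q_mean Q_var D_int D_mean w w0 om]
  have v: "(\<integral>\<^sup>+u. ennreal ((norm (u - m i))\<^sup>2) \<partial>bind (D i) Q) = ennreal (v i)"
    and vle: "v i \<le> (1 + om) * w i + om * (norm (m i))\<^sup>2" if i: "i \<in> I" for i
  proof -
    have le: "(\<integral>\<^sup>+u. ennreal ((norm (u - m i))\<^sup>2) \<partial>bind (D i) Q) \<le> ennreal ((1 + om) * w i + om * (norm (m i))\<^sup>2)"
      using b(4)[OF i i i i] .
    then have "(\<integral>\<^sup>+u. ennreal ((norm (u - m i))\<^sup>2) \<partial>bind (D i) Q) < \<infinity>"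
      by (rule le_less_trans) simp
    then show eq: "(\<integral>\<^sup>+u. ennreal ((norm (u - m i))\<^sup>2) \<partial>bind (D i) Q) = ennreal (v i)"
      by (simp add: v_def)
    show "v i \<le> (1 + om) * w i + om * (norm (m i))\<^sup>2"
      using le om w0[of i] unfolding eq by (simp add: ennreal_le_iff del: ennreal_plus)
  qed
  have "(\<Sum>i\<in>I. v i) \<le> (1 + om) * (\<Sum>i\<in>I. w i) + om * (\<Sum>i\<in>I. (norm (m i))\<^sup>2)"
    unfolding sum_distrib_left sum.distrib[symmetric] by (rule sum_mono) (rule vle)
  also have "(1 + om) * (\<Sum>i\<in>I. w i) \<le> (1 + om) * (card I * s)"
    using om sumw by (intro mult_left_mono) auto
  finally have "(\<Sum>i\<in>I. v i) \<le> card I * ((1 + om) * s) + om * (\<Sum>i\<in>I. (norm (m i))\<^sup>2)"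
    by (simp add: mult.left_commute)
  then show ?thesis
    by (intro that[of v] b v) (auto simp: v_def)
qed

section \<open>The error recursion of one step and its constants\<close>

lemma error_constants:
  fixes G p c V B n n' r e L \<zeta> om s Lpm A :: real
  assumes G: "G \<ge> 2" and p: "0 < p" "p \<le> 1" and c: "c \<ge> 0" and B: "B \<ge> 0"
    and om: "om \<ge> 0" and s: "s \<ge> 0"
    and nn: "e \<ge> 0" "r \<ge> 0" "n' \<ge> 0" and n': "n' \<le> 2 * n + 2 * L\<^sup>2 * r"
    and V: "V = (1 + om) * s + om * (L\<^sup>2 + Lpm\<^sup>2)"
    and A: "A = 48 * B * L\<^sup>2 * c / p
        + 6 * (1 - p) / p * (4 * c / p + 1 / (2 * G)) * (om * L\<^sup>2 + (1 + om) * s)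
        + 6 * (1 - p) / p * (4 * c * (1 + om) / p + om / (2 * G)) * Lpm\<^sup>2"
  shows "(1 + p / 2) * ((1 - p) * (e + V / G * r))
      + (1 + 2 / p) * (c / (G * (G - 1)) *
        (p * (2 * G\<^sup>2 * (B * n' + \<zeta>\<^sup>2)) + (1 - p) * ((2 * (G - 1) * G * V + 2 * G\<^sup>2 * Lpm\<^sup>2) * r)))
    \<le> (1 - p / 2) * e + 24 * c * B * n + p * A / 2 * r + 12 * c * \<zeta>\<^sup>2"
proof -
  have V0: "V \<ge> 0" using om s by (simp add: V)
  \<comment> \<open>The Young factor \<open>1 + p / 2\<close> gives up half of the contraction
    \<open>1 - p\<close>; this is why \<open>p / 2\<close> was a suitable parameter.\<close>
  have "(1 + p / 2) * (1 - p) = 1 - p / 2 - p\<^sup>2 / 2"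
    by (simp add: field_simps power2_eq_square)
  then have "(1 + p / 2) * (1 - p) \<le> 1 - p / 2" by simp
  from mult_right_mono[OF this nn(1)]
  have t1: "(1 + p / 2) * (1 - p) * e \<le> (1 - p / 2) * e" .
  have "(1 + p / 2) * ((1 - p) * (V / G * r)) \<le> 3 / 2 * ((1 - p) * (V / G * r))"
    using p V0 G nn by (intro mult_right_mono) auto
  then have t2: "(1 + p / 2) * (1 - p) * (V / G * r) \<le> 3 / 2 * (1 - p) * (V / G) * r"
    by (simp only: mult.assoc)
  \<comment> \<open>This ratio appears because (R) averages over \<open>G * (G - 1)\<close> pairs
    while the dispersion bounds scale with the square of \<open>G\<close>. It is at most 2 since
    \<open>G \<ge> 2\<close>.\<close>
  define k where "k = G / (G - 1)"
  have k: "0 \<le> k" "k \<le> 2" using G by (auto simp: k_def field_simps)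
  have "c / (G * (G - 1)) *
      (p * (2 * G\<^sup>2 * (B * n' + \<zeta>\<^sup>2)) + (1 - p) * ((2 * (G - 1) * G * V + 2 * G\<^sup>2 * Lpm\<^sup>2) * r))
    = c * (k * (2 * p * (B * n' + \<zeta>\<^sup>2)) + (1 - p) * ((2 * V + k * (2 * Lpm\<^sup>2)) * r))"
    using G unfolding k_def by (simp add: divide_simps) (simp add: algebra_simps power2_eq_square)
  also have "\<dots> \<le> c * (2 * (2 * p * (B * n' + \<zeta>\<^sup>2)) + (1 - p) * ((2 * V + 2 * (2 * Lpm\<^sup>2)) * r))"
    using c k p B nn by (intro mult_left_mono add_mono mult_right_mono order_refl) auto
  also have "\<dots> = 4 * p * c * (B * n' + \<zeta>\<^sup>2) + (1 - p) * c * (2 * V + 4 * Lpm\<^sup>2) * r" (is "_ = ?X")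
    by (simp add: algebra_simps)
  finally have X: "c / (G * (G - 1)) *
      (p * (2 * G\<^sup>2 * (B * n' + \<zeta>\<^sup>2)) + (1 - p) * ((2 * (G - 1) * G * V + 2 * G\<^sup>2 * Lpm\<^sup>2) * r)) \<le> ?X" .
  have X0: "?X \<ge> 0" using p c B nn V0 by simp
  have "(1 + 2 / p) * (c / (G * (G - 1)) *
      (p * (2 * G\<^sup>2 * (B * n' + \<zeta>\<^sup>2)) + (1 - p) * ((2 * (G - 1) * G * V + 2 * G\<^sup>2 * Lpm\<^sup>2) * r)))
    \<le> (1 + 2 / p) * ?X"
    using p by (intro mult_left_mono X) auto
  \<comment> \<open>The bound \<open>1 + 2 / p \<le> 3 / p\<close> uses \<open>p \<le> 1\<close>;
    together with the factor \<open>4 * p\<close> inside \<open>?X\<close> it produces the constant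
    12.\<close>
  also have "\<dots> \<le> 3 / p * ?X"
    using p by (intro mult_right_mono X0) (simp add: field_simps)
  also have "\<dots> = 12 * c * B * n' + 12 * c * \<zeta>\<^sup>2 + 3 * c / p * (1 - p) * (2 * V + 4 * Lpm\<^sup>2) * r"
    using p by (simp add: field_simps)
  \<comment> \<open>Passing from the gradient at the new point to that at the old one doubles 12 to
    24 and creates the term of \<open>A\<close> with \<open>B * L\<^sup>2\<close>.\<close>
  also have "12 * c * B * n' \<le> 12 * c * B * (2 * n + 2 * L\<^sup>2 * r)"
    using c B n' by (intro mult_left_mono) auto
  also have "12 * c * B * (2 * n + 2 * L\<^sup>2 * r) = 24 * c * B * n + 24 * c * B * L\<^sup>2 * r"
    by (simp add: algebra_simps)
  finally have t3: "(1 + 2 / p) * (c / (G * (G - 1)) *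
      (p * (2 * G\<^sup>2 * (B * n' + \<zeta>\<^sup>2)) + (1 - p) * ((2 * (G - 1) * G * V + 2 * G\<^sup>2 * Lpm\<^sup>2) * r)))
    \<le> 24 * c * B * n + 24 * c * B * L\<^sup>2 * r + 12 * c * \<zeta>\<^sup>2
      + 3 * c / p * (1 - p) * (2 * V + 4 * Lpm\<^sup>2) * r" by simp
  have "p * A / 2 = 24 * c * B * L\<^sup>2 + 3 / 2 * (1 - p) * (V / G) + 3 * c / p * (1 - p) * (4 * V + 4 * Lpm\<^sup>2)"
    using p G unfolding A V by (simp add: divide_simps) (simp add: algebra_simps)
  \<comment> \<open>The prescribed \<open>A\<close> provides \<open>4 * V\<close> where the
    dispersion requires \<open>2 * V\<close>, so there is slack here.\<close>
  moreover have "3 * c / p * (1 - p) * (2 * V + 4 * Lpm\<^sup>2) \<le> 3 * c / p * (1 - p) * (4 * V + 4 * Lpm\<^sup>2)"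
    using c p V0 by (intro mult_left_mono) auto
  ultimately have "3 / 2 * (1 - p) * (V / G) + 24 * c * B * L\<^sup>2 + 3 * c / p * (1 - p) * (2 * V + 4 * Lpm\<^sup>2) \<le> p * A / 2"
    by simp
  from mult_right_mono[OF this nn(2)]
  have t4: "3 / 2 * (1 - p) * (V / G) * r + 24 * c * B * L\<^sup>2 * r + 3 * c / p * (1 - p) * (2 * V + 4 * Lpm\<^sup>2) * r
      \<le> p * A / 2 * r"
    by (simp only: distrib_right)
  have "(1 + p / 2) * ((1 - p) * (e + V / G * r)) = (1 + p / 2) * (1 - p) * e + (1 + p / 2) * (1 - p) * (V / G * r)"
    by (simp only: distrib_left mult.assoc)
  with t1 t2 t3 t4 show ?thesis by linarith
qed

lemma nn_integral_norm_sq_lipschitz: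
  fixes x y :: "'w \<Rightarrow> 'v::euclidean_space" and h :: "'v \<Rightarrow> 'v"
  assumes [measurable]: "x \<in> borel_measurable M" "y \<in> borel_measurable M" "h \<in> borel_measurable borel"
    and lip: "\<And>y z. norm (h y - h z) \<le> L * norm (y - z)"
    and n: "(\<integral>\<^sup>+\<omega>. ennreal ((norm (h (x \<omega>)))\<^sup>2) \<partial>M) = ennreal n" and r: "(\<integral>\<^sup>+\<omega>. ennreal ((norm (y \<omega> - x \<omega>))\<^sup>2) \<partial>M) = ennreal r"
    and nn: "n \<ge> 0" "r \<ge> 0"
  shows "(\<integral>\<^sup>+\<omega>. ennreal ((norm (h (y \<omega>)))\<^sup>2) \<partial>M) \<le> ennreal (2 * n + 2 * L\<^sup>2 * r)"
proof -
  have "(\<integral>\<^sup>+\<omega>. ennreal ((norm (h (y \<omega>)))\<^sup>2) \<partial>M)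
      \<le> (\<integral>\<^sup>+\<omega>. ennreal 2 * ennreal ((norm (h (x \<omega>)))\<^sup>2) + ennreal (2 * L\<^sup>2) * ennreal ((norm (y \<omega> - x \<omega>))\<^sup>2) \<partial>M)"
  proof (rule nn_integral_mono)
    fix \<omega>
    have "(norm (h (x \<omega>) + (h (y \<omega>) - h (x \<omega>))))\<^sup>2 \<le> 2 * (norm (h (x \<omega>)))\<^sup>2 + 2 * (norm (h (y \<omega>) - h (x \<omega>)))\<^sup>2"
      by (rule norm_add_sq_le_double)
    moreover have "(norm (h (y \<omega>) - h (x \<omega>)))\<^sup>2 \<le> (L * norm (y \<omega> - x \<omega>))\<^sup>2"
      by (intro power_mono lip) simp
    ultimately have "(norm (h (y \<omega>)))\<^sup>2 \<le> 2 * (norm (h (x \<omega>)))\<^sup>2 + 2 * L\<^sup>2 * (norm (y \<omega> - x \<omega>))\<^sup>2"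
      by (simp add: power_mult_distrib)
    then show "ennreal ((norm (h (y \<omega>)))\<^sup>2)
        \<le> ennreal 2 * ennreal ((norm (h (x \<omega>)))\<^sup>2) + ennreal (2 * L\<^sup>2) * ennreal ((norm (y \<omega> - x \<omega>))\<^sup>2)"
      by (simp only: ennreal_mult[symmetric] ennreal_plus[symmetric] zero_le_power2 zero_le_numeral
          mult_nonneg_nonneg ennreal_leI)
  qed
  also have "\<dots> = ennreal 2 * ennreal n + ennreal (2 * L\<^sup>2) * ennreal r"
    by (subst nn_integral_add) (simp_all add: nn_integral_cmult n r)
  also have "\<dots> = ennreal (2 * n + 2 * L\<^sup>2 * r)"
    using nn by (simp only: ennreal_mult[symmetric] ennreal_plus[symmetric] zero_le_power2 zero_le_numeral
          mult_nonneg_nonneg)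
  finally show ?thesis .
qed

text \<open>Both endpoints \<open>x'\<close> and \<open>x\<close> of the step are known before the
  coin is tossed. The randomness of the samples can therefore be estimated with the endpoints fixed
  at \<open>a'\<close> and \<open>a\<close>, and the result integrated over the past. The aggregator
  is accessible only through the full expectation in (R).\<close>

lemma marina_error_step:
  fixes M :: "'w measure" and GG :: "nat set" and nf :: "nat \<Rightarrow> 'v::euclidean_space \<Rightarrow> 'v"
    and x x' g g' :: "'w \<Rightarrow> 'v" and q gi :: "nat \<Rightarrow> 'w \<Rightarrow> 'v" and coin :: "'w \<Rightarrow> bool"
    and c B \<zeta> L Lpm s om p A e n r :: real
  assumes gradf_def: "gradf = (\<lambda>z. (1 / real (card GG)) *\<^sub>R (\<Sum>i\<in>GG. nf i z))"
    and M: "prob_space M" and sub: "subalgebra M F"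
    and fin: "finite GG" and G2: "card GG \<ge> 2"
    and A1: "\<And>y z. norm (gradf y - gradf z) \<le> L * norm (y - z)"
    and B: "B \<ge> 0"
    and A2: "\<And>z. (\<Sum>i\<in>GG. (norm (nf i z - gradf z))\<^sup>2) / real (card GG) \<le> B * (norm (gradf z))\<^sup>2 + \<zeta>\<^sup>2"
    and A3: "\<And>y z. (\<Sum>i\<in>GG. (norm (nf i y - nf i z))\<^sup>2) / real (card GG)
                    - (norm (gradf y - gradf z))\<^sup>2 \<le> Lpm\<^sup>2 * (norm (y - z))\<^sup>2"
    and s: "s \<ge> 0"
    and D_kernel: "\<And>i. i \<in> GG \<Longrightarrow> (\<lambda>(y, z). D i y z) \<in> borel \<rightarrow>\<^sub>M prob_algebra borel"
    and A4_int: "\<And>i y z. i \<in> GG \<Longrightarrow> integrable (D i y z) (\<lambda>v. v)"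
    and A4_mean: "\<And>i y z. i \<in> GG \<Longrightarrow> (\<integral>v. v \<partial>D i y z) = nf i y - nf i z"
    and A4_var: "\<And>y z. ennreal (1 / real (card GG)) *
                   (\<Sum>i\<in>GG. \<integral>\<^sup>+v. ennreal ((norm (v - (nf i y - nf i z)))\<^sup>2) \<partial>D i y z)
                 \<le> ennreal (s * (norm (y - z))\<^sup>2)"
    and om: "om \<ge> 0"
    and Q_kernel: "Qd \<in> borel \<rightarrow>\<^sub>M prob_algebra borel"
    and Q_int: "\<And>v. integrable (Qd v) (\<lambda>u. u)" and Q_mean: "\<And>v. (\<integral>u. u \<partial>Qd v) = v"
    and Q_var: "\<And>v. (\<integral>\<^sup>+u. ennreal ((norm (u - v))\<^sup>2) \<partial>Qd v) \<le> ennreal (om * (norm v)\<^sup>2)"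
    and p: "0 < p" "p \<le> 1"
    and xm: "x \<in> borel_measurable F" and x'm: "x' \<in> borel_measurable F" and gm: "g \<in> borel_measurable F"
    and g'm[measurable]: "g' \<in> borel_measurable M"
    and q_meas[measurable]: "\<And>i. i \<in> GG \<Longrightarrow> q i \<in> borel_measurable M"
    and coin_meas[measurable]: "coin \<in> M \<rightarrow>\<^sub>M count_space UNIV"
    and coin_bern: "\<And>A. A \<in> sets F \<Longrightarrow> measure M (A \<inter> {\<omega>\<in>space M. coin \<omega>}) = p * measure M A"
    and q_law: "\<And>A S. A \<in> sets F \<Longrightarrow> S \<in> sets (PiM GG (\<lambda>_. borel)) \<Longrightarrow>
        measure M (A \<inter> {\<omega>\<in>space M. coin \<omega> = False} \<inter> {\<omega>\<in>space M. (\<lambda>i\<in>GG. q i \<omega>) \<in> S})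
        = (\<integral>\<omega>\<in>(A \<inter> {\<omega>\<in>space M. coin \<omega> = False}). measure (step_kernel GG D Qd (x' \<omega>) (x \<omega>)) S \<partial>M)"
    and good: "\<And>i \<omega>. i \<in> GG \<Longrightarrow> \<omega> \<in> space M \<Longrightarrow> gi i \<omega> = (if coin \<omega> then nf i (x' \<omega>) else g \<omega> + q i \<omega>)"
    and c: "c \<ge> 0"
    and R: "(\<integral>\<^sup>+\<omega>. ennreal ((norm (g' \<omega> - (1 / real (card GG)) *\<^sub>R (\<Sum>i\<in>GG. gi i \<omega>)))\<^sup>2) \<partial>M)
         \<le> ennreal (c / (real (card GG) * (real (card GG) - 1))) *
           (\<Sum>i\<in>GG. \<Sum>l\<in>GG. \<integral>\<^sup>+\<omega>. ennreal ((norm (gi i \<omega> - gi l \<omega>))\<^sup>2) \<partial>M)"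
    and A: "A = 48 * B * L\<^sup>2 * c / p
        + 6 * (1 - p) / p * (4 * c / p + 1 / (2 * real (card GG))) * (om * L\<^sup>2 + (1 + om) * s)
        + 6 * (1 - p) / p * (4 * c * (1 + om) / p + om / (2 * real (card GG))) * Lpm\<^sup>2"
    and e: "(\<integral>\<^sup>+\<omega>. ennreal ((norm (g \<omega> - gradf (x \<omega>)))\<^sup>2) \<partial>M) = ennreal e" "e \<ge> 0"
    and n: "(\<integral>\<^sup>+\<omega>. ennreal ((norm (gradf (x \<omega>)))\<^sup>2) \<partial>M) = ennreal n" "n \<ge> 0"
    and r: "(\<integral>\<^sup>+\<omega>. ennreal ((norm (x' \<omega> - x \<omega>))\<^sup>2) \<partial>M) = ennreal r" "r \<ge> 0"
  shows "(\<integral>\<^sup>+\<omega>. ennreal ((norm (g' \<omega> - gradf (x' \<omega>)))\<^sup>2) \<partial>M)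
    \<le> ennreal ((1 - p / 2) * e + 24 * c * B * n + p * A / 2 * r + 12 * c * \<zeta>\<^sup>2)"
proof -
  interpret prob_space M by fact
  define G where "G = real (card GG)"
  have G: "G \<ge> 2" using G2 by (simp add: G_def)
  have ne: "GG \<noteq> {}" using G2 by auto
  define C where "C = {\<omega>\<in>space M. coin \<omega>}"
  define C' where "C' = {\<omega>\<in>space M. coin \<omega> = False}"
  have [measurable]: "C \<in> sets M" "C' \<in> sets M" unfolding C_def C'_def by measurable
  have spF: "space F = space M" using sub by (simp add: subalgebra_def)
  note [measurable] = measurable_from_subalg[OF sub xm] measurable_from_subalg[OF sub x'm] measurable_from_subalg[OF sub gm]

  \<comment> \<open>(A3) bounds the variance of the local gradient differences over the workers and
    (A1) their mean. Together they bound the mean square, with which the compression noise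
    scales.\<close>
  have dev: "(\<Sum>i\<in>GG. (norm (nf i y - nf i z))\<^sup>2) \<le> G * (L\<^sup>2 + Lpm\<^sup>2) * (norm (y - z))\<^sup>2" for y z
  proof -
    have "(norm (gradf y - gradf z))\<^sup>2 \<le> (L * norm (y - z))\<^sup>2"
      by (intro power_mono A1) simp
    then have "(\<Sum>i\<in>GG. (norm (nf i y - nf i z))\<^sup>2) / G \<le> (L\<^sup>2 + Lpm\<^sup>2) * (norm (y - z))\<^sup>2"
      using A3[of y z] by (simp add: G_def power_mult_distrib distrib_right)
    then show ?thesis using G by (simp add: field_simps)
  qed
  \<comment> \<open>Each local gradient is one term of the sum in \<open>dev\<close>, hence
    Lipschitz and in particular measurable.\<close>
  have [measurable]: "nf i \<in> borel_measurable borel" if i: "i \<in> GG" for i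
  proof (rule borel_measurable_continuous_onI, rule lipschitz_on_continuous_on)
    show "(sqrt (G * (L\<^sup>2 + Lpm\<^sup>2)))-lipschitz_on UNIV (nf i)"
    proof (rule lipschitz_onI)
      fix y z
      have "(norm (nf i y - nf i z))\<^sup>2 \<le> (\<Sum>i\<in>GG. (norm (nf i y - nf i z))\<^sup>2)"
        using i fin by (intro member_le_sum) auto
      also have "\<dots> \<le> G * (L\<^sup>2 + Lpm\<^sup>2) * (norm (y - z))\<^sup>2" by (rule dev)
      finally have "norm (nf i y - nf i z) \<le> sqrt (G * (L\<^sup>2 + Lpm\<^sup>2) * (norm (y - z))\<^sup>2)"
        by (rule real_le_rsqrt)
      then show "dist (nf i y) (nf i z) \<le> sqrt (G * (L\<^sup>2 + Lpm\<^sup>2)) * dist y z"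
        by (simp add: dist_norm real_sqrt_mult)
    qed (use G in simp)
  qed
  have [measurable]: "gradf \<in> borel_measurable borel" unfolding gradf_def by measurable

  have coinF: "measure M (H \<inter> C') = (1 - p) * measure M H" if "H \<in> sets F" for H
  proof -
    have H: "H \<in> sets M" using that sub by (auto simp: subalgebra_def)
    have "H \<inter> C' = H - (H \<inter> C)" using sets.sets_into_space[OF H] by (auto simp: C_def C'_def)
    then have "measure M (H \<inter> C') = measure M H - measure M (H \<inter> C)"
      using H by (simp add: finite_measure_Diff)
    then show ?thesis using coin_bern[OF that] by (simp add: C_def left_diff_distrib)
  qed
  have heads: "(\<integral>\<^sup>+\<omega>. indicator C \<omega> * u \<omega> \<partial>M) = ennreal p * (\<integral>\<^sup>+\<omega>. u \<omega> \<partial>M)"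
    if "u \<in> borel_measurable F" for u
    using p coin_bern that
    by (intro nn_integral_indicator_indep[OF finite_measure_axioms sub])
       (auto simp: emeasure_eq_measure ennreal_mult C_def)
  have split: "(\<integral>\<^sup>+\<omega>. u \<omega> \<partial>M) = (\<integral>\<^sup>+\<omega>. indicator C \<omega> * u \<omega> \<partial>M) + (\<integral>\<^sup>+\<omega>. indicator C' \<omega> * u \<omega> \<partial>M)"
    if [measurable]: "u \<in> borel_measurable M" for u :: "'w \<Rightarrow> ennreal"
    by (subst nn_integral_add[symmetric])
       (auto intro!: nn_integral_cong simp: C_def C'_def split: split_indicator)

  let ?X = "borel \<Otimes>\<^sub>M (borel \<Otimes>\<^sub>M borel) :: ('v \<times> 'v \<times> 'v) measure"
  let ?Z = "PiM GG (\<lambda>_. borel) :: (nat \<Rightarrow> 'v) measure"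
  define \<kappa> where "\<kappa> t = step_kernel GG D Qd (fst t) (fst (snd t))" for t :: "'v \<times> 'v \<times> 'v"
  \<comment> \<open>The endpoints select the kernel; \<open>g\<close> is carried along because the
    averaged message on tails is compared with it under the integral.\<close>
  define T where "T \<omega> = (x' \<omega>, x \<omega>, g \<omega>)" for \<omega>
  have T: "T \<in> F \<rightarrow>\<^sub>M ?X" unfolding T_def using xm x'm gm by measurable
  have \<kappa>: "\<kappa> \<in> ?X \<rightarrow>\<^sub>M prob_algebra ?Z"
    unfolding \<kappa>_def step_kernel_def
  proof (rule measurable_PiM_prob_algebra[OF fin])
    fix i assume i: "i \<in> GG"
    have "(\<lambda>t. (fst t, fst (snd t))) \<in> ?X \<rightarrow>\<^sub>M (borel :: ('v \<times> 'v) measure)"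
      unfolding borel_prod[symmetric] by measurable
    from measurable_compose[OF this D_kernel[OF i]]
    have "(\<lambda>t. D i (fst t) (fst (snd t))) \<in> ?X \<rightarrow>\<^sub>M prob_algebra borel" by simp
    then show "(\<lambda>t. D i (fst t) (fst (snd t)) \<bind> Qd) \<in> ?X \<rightarrow>\<^sub>M prob_algebra borel"
      by (rule measurable_bind_prob_space[OF _ Q_kernel])
  qed
  have tails: "(\<integral>\<^sup>+\<omega>. indicator C' \<omega> * h (T \<omega>, \<lambda>i\<in>GG. q i \<omega>) \<partial>M)
      = ennreal (1 - p) * (\<integral>\<^sup>+\<omega>. \<integral>\<^sup>+y. h (T \<omega>, y) \<partial>step_kernel GG D Qd (x' \<omega>) (x \<omega>) \<partial>M)"
    if "h \<in> borel_measurable (?X \<Otimes>\<^sub>M ?Z)" for h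
  proof -
    have "(\<integral>\<^sup>+\<omega>. indicator C' \<omega> * h (T \<omega>, \<lambda>i\<in>GG. q i \<omega>) \<partial>M)
        = ennreal (1 - p) * (\<integral>\<^sup>+\<omega>. \<integral>\<^sup>+y. h (T \<omega>, y) \<partial>\<kappa> (T \<omega>) \<partial>M)"
      using p coinF q_law[folded C'_def]
      by (intro nn_integral_fresh_sample[OF M sub _ _ _ T _ \<kappa> _ that])
         (auto simp: \<kappa>_def T_def)
    then show ?thesis by (simp add: \<kappa>_def T_def)
  qed

  \<comment> \<open>Average variance of the compressed estimators per unit of squared step length:
    estimator noise amplified by compression, plus compression of the mean differences bounded by
    \<open>dev\<close>.\<close>
  define V where "V = (1 + om) * s + om * (L\<^sup>2 + Lpm\<^sup>2)"
  have V0: "V \<ge> 0" using om s by (simp add: V_def)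
  have kernel_avg: "(\<integral>\<^sup>+y. ennreal ((norm (z + (1 / G) *\<^sub>R (\<Sum>i\<in>GG. y i) - gradf a'))\<^sup>2) \<partial>step_kernel GG D Qd a' a)
      \<le> ennreal ((norm (z - gradf a))\<^sup>2 + V / G * (norm (a' - a))\<^sup>2)"
    and kernel_diff: "(\<Sum>i\<in>GG. \<Sum>l\<in>GG. \<integral>\<^sup>+y. ennreal ((norm (y i - y l))\<^sup>2) \<partial>step_kernel GG D Qd a' a)
      \<le> ennreal ((2 * (G - 1) * G * V + 2 * G\<^sup>2 * Lpm\<^sup>2) * (norm (a' - a))\<^sup>2)" for z a a'
  proof -
    define m where "m i = nf i a' - nf i a" for i
    define P where "P i = bind (D i a' a) Qd" for i
    have Dp: "D i a' a \<in> space (prob_algebra borel)" if "i \<in> GG" for i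
      using measurable_space[OF D_kernel[OF that], of "(a', a)"] by simp
    have s': "s * (norm (a' - a))\<^sup>2 \<ge> 0" using s by simp
    obtain v :: "nat \<Rightarrow> real" where v:
      "\<And>i. i \<in> GG \<Longrightarrow> P i \<in> space (prob_algebra borel)"
      "\<And>i. i \<in> GG \<Longrightarrow> integrable (P i) (\<lambda>u. u)"
      "\<And>i. i \<in> GG \<Longrightarrow> (\<integral>u. u \<partial>P i) = m i"
      "\<And>i. i \<in> GG \<Longrightarrow> (\<integral>\<^sup>+u. ennreal ((norm (u - m i))\<^sup>2) \<partial>P i) = ennreal (v i)"
      "\<And>i. i \<in> GG \<Longrightarrow> v i \<ge> 0"
      and sumv: "(\<Sum>i\<in>GG. v i) \<le> card GG * ((1 + om) * (s * (norm (a' - a))\<^sup>2)) + om * (\<Sum>i\<in>GG. (norm (m i))\<^sup>2)"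
      unfolding P_def m_def
      by (rule compressed_estimator_variances[OF fin ne Dp A4_int A4_mean A4_var s'
            Q_kernel Q_int Q_mean Q_var om]) auto
    have "om * (\<Sum>i\<in>GG. (norm (m i))\<^sup>2) \<le> om * (G * (L\<^sup>2 + Lpm\<^sup>2) * (norm (a' - a))\<^sup>2)"
      unfolding m_def by (intro mult_left_mono dev om)
    with sumv have sumv: "(\<Sum>i\<in>GG. v i) \<le> G * V * (norm (a' - a))\<^sup>2"
      by (simp add: G_def V_def algebra_simps)
    have K: "step_kernel GG D Qd a' a = PiM GG P"
      by (simp add: step_kernel_def P_def[abs_def])
    have avg: "gradf a' - gradf a = (1 / G) *\<^sub>R (\<Sum>i\<in>GG. m i)"
      by (simp add: gradf_def m_def G_def sum_subtractf scaleR_diff_right)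
    have "z + (1 / G) *\<^sub>R (\<Sum>i\<in>GG. y i) - gradf a'
        = (z - gradf a) + (\<Sum>i\<in>GG. (1 / G) *\<^sub>R (y i - m i))" for y
    proof -
      have "(\<Sum>i\<in>GG. (1 / G) *\<^sub>R (y i - m i)) = (1 / G) *\<^sub>R (\<Sum>i\<in>GG. y i) - (gradf a' - gradf a)"
        unfolding avg by (simp add: scaleR_sum_right[symmetric] sum_subtractf scaleR_diff_right)
      then show ?thesis by simp
    qed
    then have "(\<integral>\<^sup>+y. ennreal ((norm (z + (1 / G) *\<^sub>R (\<Sum>i\<in>GG. y i) - gradf a'))\<^sup>2) \<partial>PiM GG P)
        = ennreal ((norm (z - gradf a))\<^sup>2 + (\<Sum>i\<in>GG. (1 / G)\<^sup>2 * v i))"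
      by (simp only:) (rule nn_integral_PiM_norm_sq[OF fin order_refl v])
    also have "(\<Sum>i\<in>GG. (1 / G)\<^sup>2 * v i) = (1 / G)\<^sup>2 * (\<Sum>i\<in>GG. v i)"
      by (simp add: sum_distrib_left)
    also have "\<dots> \<le> (1 / G)\<^sup>2 * (G * V * (norm (a' - a))\<^sup>2)"
      by (intro mult_left_mono sumv) simp
    \<comment> \<open>Averaging independent errors brings the square of \<open>1 / G\<close> against
      a sum of order \<open>G\<close>, which leaves the gain \<open>1 / G\<close>.\<close>
    also have "(1 / G)\<^sup>2 * (G * V * (norm (a' - a))\<^sup>2) = V / G * (norm (a' - a))\<^sup>2"
      using G by (simp add: field_simps power2_eq_square)
    finally show "(\<integral>\<^sup>+y. ennreal ((norm (z + (1 / G) *\<^sub>R (\<Sum>i\<in>GG. y i) - gradf a'))\<^sup>2) \<partial>step_kernel GG D Qd a' a)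
      \<le> ennreal ((norm (z - gradf a))\<^sup>2 + V / G * (norm (a' - a))\<^sup>2)"
      unfolding K by (simp add: ennreal_leI)
    \<comment> \<open>The left side of (A3), mean square minus squared mean, is this centered sum
      divided by \<open>G\<close>.\<close>
    have "(\<Sum>i\<in>GG. (norm (m i - (1 / G) *\<^sub>R (\<Sum>i\<in>GG. m i)))\<^sup>2)
        = (\<Sum>i\<in>GG. (norm (m i))\<^sup>2) - G * (norm (gradf a' - gradf a))\<^sup>2"
      unfolding avg G_def by (rule sum_norm_diff_mean_sq[OF fin ne])
    also have "\<dots> \<le> G * (Lpm\<^sup>2 * (norm (a' - a))\<^sup>2)"
      using A3[of a' a] G by (simp add: G_def[symmetric] m_def field_simps)
    finally have "2 * G * (\<Sum>i\<in>GG. (norm (m i - (1 / G) *\<^sub>R (\<Sum>i\<in>GG. m i)))\<^sup>2)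
        \<le> 2 * G * (G * (Lpm\<^sup>2 * (norm (a' - a))\<^sup>2))"
      using G by (intro mult_left_mono) auto
    then have mm: "(\<Sum>i\<in>GG. \<Sum>l\<in>GG. (norm (m i - m l))\<^sup>2) \<le> 2 * G\<^sup>2 * Lpm\<^sup>2 * (norm (a' - a))\<^sup>2"
      unfolding sum_sum_norm_diff_sq_mean[OF fin ne] G_def[symmetric]
      by (simp add: power2_eq_square mult_ac)
    have vv: "2 * (G - 1) * (\<Sum>i\<in>GG. v i) \<le> 2 * (G - 1) * (G * V * (norm (a' - a))\<^sup>2)"
      using G by (intro mult_left_mono sumv) auto
    have "(\<Sum>i\<in>GG. \<Sum>l\<in>GG. \<integral>\<^sup>+y. ennreal ((norm (y i - y l))\<^sup>2) \<partial>PiM GG P)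
        = ennreal (2 * (G - 1) * (\<Sum>i\<in>GG. v i) + (\<Sum>i\<in>GG. \<Sum>l\<in>GG. (norm (m i - m l))\<^sup>2))"
      unfolding G_def by (rule sum_nn_integral_PiM_norm_diff_sq[OF fin ne v])
    also have "\<dots> \<le> ennreal ((2 * (G - 1) * G * V + 2 * G\<^sup>2 * Lpm\<^sup>2) * (norm (a' - a))\<^sup>2)"
      using mm vv by (intro ennreal_leI) (simp add: distrib_right mult.assoc)
    finally show "(\<Sum>i\<in>GG. \<Sum>l\<in>GG. \<integral>\<^sup>+y. ennreal ((norm (y i - y l))\<^sup>2) \<partial>step_kernel GG D Qd a' a)
      \<le> ennreal ((2 * (G - 1) * G * V + 2 * G\<^sup>2 * Lpm\<^sup>2) * (norm (a' - a))\<^sup>2)"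
      unfolding K .
  qed

  have gi_meas[measurable]: "gi i \<in> borel_measurable M" if i: "i \<in> GG" for i
  proof -
    have "(\<lambda>\<omega>. if coin \<omega> then nf i (x' \<omega>) else g \<omega> + q i \<omega>) \<in> borel_measurable M"
      using i by measurable
    then show ?thesis by (rule measurable_cong[THEN iffD2, rotated]) (rule good[OF i])
  qed
  define gbar where "gbar \<omega> = (1 / G) *\<^sub>R (\<Sum>i\<in>GG. gi i \<omega>)" for \<omega>
  have [measurable]: "gbar \<in> borel_measurable M" unfolding gbar_def by measurable

  have W1: "(\<integral>\<^sup>+\<omega>. ennreal ((norm (gbar \<omega> - gradf (x' \<omega>)))\<^sup>2) \<partial>M) \<le> ennreal ((1 - p) * (e + V / G * r))"
  proof -
    define h where "h = (\<lambda>(t :: 'v \<times> 'v \<times> 'v, y :: nat \<Rightarrow> 'v).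
      ennreal ((norm (snd (snd t) + (1 / G) *\<^sub>R (\<Sum>i\<in>GG. y i) - gradf (fst t)))\<^sup>2))"
    have h: "h \<in> borel_measurable (?X \<Otimes>\<^sub>M ?Z)" unfolding h_def by measurable
    \<comment> \<open>On heads the good workers send exact gradients, so their average is
      \<open>gradf (x' \<omega>)\<close> and this part vanishes.\<close>
    have "(\<integral>\<^sup>+\<omega>. indicator C \<omega> * ennreal ((norm (gbar \<omega> - gradf (x' \<omega>)))\<^sup>2) \<partial>M) = (\<integral>\<^sup>+\<omega>. 0 \<partial>M)"
      by (intro nn_integral_cong)
         (auto simp: C_def gbar_def gradf_def good G_def split: split_indicator)
    moreover have "(\<integral>\<^sup>+\<omega>. indicator C' \<omega> * ennreal ((norm (gbar \<omega> - gradf (x' \<omega>)))\<^sup>2) \<partial>M)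
        = (\<integral>\<^sup>+\<omega>. indicator C' \<omega> * h (T \<omega>, \<lambda>i\<in>GG. q i \<omega>) \<partial>M)"
    proof (rule nn_integral_cong)
      fix \<omega> assume \<omega>: "\<omega> \<in> space M"
      have "gbar \<omega> = g \<omega> + (1 / G) *\<^sub>R (\<Sum>i\<in>GG. q i \<omega>)" if "\<omega> \<in> C'"
        using that G by (simp add: C'_def gbar_def good sum.distrib sum_constant_scaleR
            scaleR_add_right G_def[symmetric])
      then show "indicator C' \<omega> * ennreal ((norm (gbar \<omega> - gradf (x' \<omega>)))\<^sup>2)
          = indicator C' \<omega> * h (T \<omega>, \<lambda>i\<in>GG. q i \<omega>)"
        by (auto simp: h_def T_def split: split_indicator)
    qed
    moreover have "(\<integral>\<^sup>+\<omega>. \<integral>\<^sup>+y. h (T \<omega>, y) \<partial>step_kernel GG D Qd (x' \<omega>) (x \<omega>) \<partial>M)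
        \<le> (\<integral>\<^sup>+\<omega>. ennreal ((norm (g \<omega> - gradf (x \<omega>)))\<^sup>2) + ennreal (V / G) * ennreal ((norm (x' \<omega> - x \<omega>))\<^sup>2) \<partial>M)"
      using kernel_avg V0 G
      by (intro nn_integral_mono) (simp add: h_def T_def ennreal_mult[symmetric] ennreal_plus[symmetric] del: ennreal_plus)
    moreover have "\<dots> = ennreal (e + V / G * r)"
      using e r V0 G
      by (simp add: nn_integral_add nn_integral_cmult)
         (simp add: ennreal_mult[symmetric] ennreal_plus[symmetric] del: ennreal_plus)
    ultimately have "(\<integral>\<^sup>+\<omega>. ennreal ((norm (gbar \<omega> - gradf (x' \<omega>)))\<^sup>2) \<partial>M) \<le> ennreal (1 - p) * ennreal (e + V / G * r)"
      by (subst split) (simp_all add: tails[OF h] mult_left_mono)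
    also have "\<dots> = ennreal ((1 - p) * (e + V / G * r))"
      using p e r V0 G by (simp add: ennreal_mult)
    finally show ?thesis .
  qed

  \<comment> \<open>On heads the messages are gradients at \<open>x'\<close>, so (A2) brings in the
    gradient at the new point. Its second moment is first shown to be finite, so that it can be
    treated as a real number.\<close>
  define n' where "n' = enn2real (\<integral>\<^sup>+\<omega>. ennreal ((norm (gradf (x' \<omega>)))\<^sup>2) \<partial>M)"
  have n'_le: "(\<integral>\<^sup>+\<omega>. ennreal ((norm (gradf (x' \<omega>)))\<^sup>2) \<partial>M) \<le> ennreal (2 * n + 2 * L\<^sup>2 * r)"
    by (rule nn_integral_norm_sq_lipschitz[OF _ _ _ A1 n(1) r(1) n(2) r(2)]) measurable
  then have "(\<integral>\<^sup>+\<omega>. ennreal ((norm (gradf (x' \<omega>)))\<^sup>2) \<partial>M) < \<infinity>"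
    by (rule le_less_trans) simp
  then have n': "(\<integral>\<^sup>+\<omega>. ennreal ((norm (gradf (x' \<omega>)))\<^sup>2) \<partial>M) = ennreal n'"
    by (simp add: n'_def)
  have n'0: "n' \<ge> 0" by (simp add: n'_def)
  have n'2: "n' \<le> 2 * n + 2 * L\<^sup>2 * r"
    using n'_le n r unfolding n' by (simp add: ennreal_le_iff del: ennreal_plus)

  define W where "W = p * (2 * G\<^sup>2 * (B * n' + \<zeta>\<^sup>2)) + (1 - p) * ((2 * (G - 1) * G * V + 2 * G\<^sup>2 * Lpm\<^sup>2) * r)"
  have W0: "W \<ge> 0" unfolding W_def using p B n'0 G V0 r by simp
  have disp: "(\<Sum>i\<in>GG. \<Sum>l\<in>GG. \<integral>\<^sup>+\<omega>. ennreal ((norm (gi i \<omega> - gi l \<omega>))\<^sup>2) \<partial>M) \<le> ennreal W"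
  proof -
    define k where "k i l = (\<lambda>(t :: 'v \<times> 'v \<times> 'v, y :: nat \<Rightarrow> 'v). ennreal ((norm (y i - y l))\<^sup>2))" for i l
    have k: "k i l \<in> borel_measurable (?X \<Otimes>\<^sub>M ?Z)" if "i \<in> GG" "l \<in> GG" for i l
      unfolding k_def using that by measurable
    have K_meas: "(\<lambda>\<omega>. \<integral>\<^sup>+y. k i l (T \<omega>, y) \<partial>step_kernel GG D Qd (x' \<omega>) (x \<omega>)) \<in> borel_measurable M"
      if il: "i \<in> GG" "l \<in> GG" for i l
    proof -
      have "(\<lambda>t. \<integral>\<^sup>+y. k i l (t, y) \<partial>\<kappa> t) \<in> borel_measurable ?X"
        using k[OF il] by (intro nn_integral_measurable_subprob_algebra2[OF _ measurable_prob_algebraD[OF \<kappa>]]) simp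
      from measurable_compose[OF measurable_from_subalg[OF sub T] this]
      show ?thesis by (simp add: \<kappa>_def T_def)
    qed
    have nfF: "(\<lambda>\<omega>. ennreal ((norm (nf i (x' \<omega>) - nf l (x' \<omega>)))\<^sup>2)) \<in> borel_measurable F" if "i \<in> GG" "l \<in> GG" for i l
      using x'm that by measurable
    have one: "(\<integral>\<^sup>+\<omega>. ennreal ((norm (gi i \<omega> - gi l \<omega>))\<^sup>2) \<partial>M)
        = ennreal p * (\<integral>\<^sup>+\<omega>. ennreal ((norm (nf i (x' \<omega>) - nf l (x' \<omega>)))\<^sup>2) \<partial>M)
          + ennreal (1 - p) * (\<integral>\<^sup>+\<omega>. \<integral>\<^sup>+y. k i l (T \<omega>, y) \<partial>step_kernel GG D Qd (x' \<omega>) (x \<omega>) \<partial>M)"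
      if il: "i \<in> GG" "l \<in> GG" for i l
    proof -
      have "(\<integral>\<^sup>+\<omega>. ennreal ((norm (gi i \<omega> - gi l \<omega>))\<^sup>2) \<partial>M)
        = (\<integral>\<^sup>+\<omega>. indicator C \<omega> * ennreal ((norm (gi i \<omega> - gi l \<omega>))\<^sup>2) \<partial>M)
          + (\<integral>\<^sup>+\<omega>. indicator C' \<omega> * ennreal ((norm (gi i \<omega> - gi l \<omega>))\<^sup>2) \<partial>M)"
        using il by (intro split) measurable
      also have "(\<integral>\<^sup>+\<omega>. indicator C \<omega> * ennreal ((norm (gi i \<omega> - gi l \<omega>))\<^sup>2) \<partial>M)
          = (\<integral>\<^sup>+\<omega>. indicator C \<omega> * ennreal ((norm (nf i (x' \<omega>) - nf l (x' \<omega>)))\<^sup>2) \<partial>M)"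
        using il by (intro nn_integral_cong) (auto simp: C_def good split: split_indicator)
      \<comment> \<open>On tails the common vector \<open>g\<close> cancels in the difference of two
        messages, so only the compressed estimators remain.\<close>
      also have "(\<integral>\<^sup>+\<omega>. indicator C' \<omega> * ennreal ((norm (gi i \<omega> - gi l \<omega>))\<^sup>2) \<partial>M)
          = (\<integral>\<^sup>+\<omega>. indicator C' \<omega> * k i l (T \<omega>, \<lambda>i\<in>GG. q i \<omega>) \<partial>M)"
        using il by (intro nn_integral_cong) (auto simp: C'_def good k_def split: split_indicator)
      finally show ?thesis
        unfolding heads[OF nfF[OF il]] tails[OF k[OF il]] .
    qed
    have "(\<Sum>i\<in>GG. \<Sum>l\<in>GG. \<integral>\<^sup>+\<omega>. ennreal ((norm (nf i (x' \<omega>) - nf l (x' \<omega>)))\<^sup>2) \<partial>M)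
        = (\<integral>\<^sup>+\<omega>. (\<Sum>i\<in>GG. \<Sum>l\<in>GG. ennreal ((norm (nf i (x' \<omega>) - nf l (x' \<omega>)))\<^sup>2)) \<partial>M)"
      by (simp add: nn_integral_sum del: sum_ennreal)
    also have "\<dots> \<le> (\<integral>\<^sup>+\<omega>. ennreal (2 * G\<^sup>2 * B) * ennreal ((norm (gradf (x' \<omega>)))\<^sup>2) + ennreal (2 * G\<^sup>2 * \<zeta>\<^sup>2) \<partial>M)"
    proof (rule nn_integral_mono)
      fix \<omega>
      have "(\<Sum>i\<in>GG. \<Sum>l\<in>GG. (norm (nf i (x' \<omega>) - nf l (x' \<omega>)))\<^sup>2)
          = 2 * G * (\<Sum>i\<in>GG. (norm (nf i (x' \<omega>) - gradf (x' \<omega>)))\<^sup>2)"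
        unfolding G_def gradf_def by (rule sum_sum_norm_diff_sq_mean[OF fin ne])
      also have "\<dots> \<le> 2 * G * (G * (B * (norm (gradf (x' \<omega>)))\<^sup>2 + \<zeta>\<^sup>2))"
        using A2[of "x' \<omega>"] G by (intro mult_left_mono) (auto simp: G_def[symmetric] field_simps)
      also have "\<dots> = 2 * G\<^sup>2 * B * (norm (gradf (x' \<omega>)))\<^sup>2 + 2 * G\<^sup>2 * \<zeta>\<^sup>2"
        by (simp add: power2_eq_square algebra_simps)
      finally have "ennreal (\<Sum>i\<in>GG. \<Sum>l\<in>GG. (norm (nf i (x' \<omega>) - nf l (x' \<omega>)))\<^sup>2)
          \<le> ennreal (2 * G\<^sup>2 * B * (norm (gradf (x' \<omega>)))\<^sup>2 + 2 * G\<^sup>2 * \<zeta>\<^sup>2)"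
        by (rule ennreal_leI)
      then show "(\<Sum>i\<in>GG. \<Sum>l\<in>GG. ennreal ((norm (nf i (x' \<omega>) - nf l (x' \<omega>)))\<^sup>2))
          \<le> ennreal (2 * G\<^sup>2 * B) * ennreal ((norm (gradf (x' \<omega>)))\<^sup>2) + ennreal (2 * G\<^sup>2 * \<zeta>\<^sup>2)"
        using B by (simp add: sum_ennreal sum_nonneg ennreal_mult[symmetric] ennreal_plus[symmetric] del: ennreal_plus)
    qed
    also have "\<dots> = ennreal (2 * G\<^sup>2 * (B * n' + \<zeta>\<^sup>2))"
    proof -
      have "(\<integral>\<^sup>+\<omega>. ennreal (2 * G\<^sup>2 * B) * ennreal ((norm (gradf (x' \<omega>)))\<^sup>2) + ennreal (2 * G\<^sup>2 * \<zeta>\<^sup>2) \<partial>M)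
        = ennreal (2 * G\<^sup>2 * B) * ennreal n' + ennreal (2 * G\<^sup>2 * \<zeta>\<^sup>2)"
        by (subst nn_integral_add) (simp_all add: nn_integral_cmult n' emeasure_space_1)
      then show ?thesis
        using B n'0 by (simp add: ennreal_mult[symmetric] ennreal_plus[symmetric] distrib_left mult.assoc del: ennreal_plus)
    qed
    finally have S1: "(\<Sum>i\<in>GG. \<Sum>l\<in>GG. \<integral>\<^sup>+\<omega>. ennreal ((norm (nf i (x' \<omega>) - nf l (x' \<omega>)))\<^sup>2) \<partial>M)
        \<le> ennreal (2 * G\<^sup>2 * (B * n' + \<zeta>\<^sup>2))" .
    define U where "U = 2 * (G - 1) * G * V + 2 * G\<^sup>2 * Lpm\<^sup>2"
    have U0: "U \<ge> 0" using G V0 by (simp add: U_def)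
    have "(\<Sum>i\<in>GG. \<Sum>l\<in>GG. \<integral>\<^sup>+\<omega>. \<integral>\<^sup>+y. k i l (T \<omega>, y) \<partial>step_kernel GG D Qd (x' \<omega>) (x \<omega>) \<partial>M)
        = (\<integral>\<^sup>+\<omega>. (\<Sum>i\<in>GG. \<Sum>l\<in>GG. \<integral>\<^sup>+y. k i l (T \<omega>, y) \<partial>step_kernel GG D Qd (x' \<omega>) (x \<omega>)) \<partial>M)"
      using K_meas by (simp add: nn_integral_sum)
    also have "\<dots> \<le> (\<integral>\<^sup>+\<omega>. ennreal U * ennreal ((norm (x' \<omega> - x \<omega>))\<^sup>2) \<partial>M)"
      using kernel_diff[folded U_def] U0 by (intro nn_integral_mono) (simp add: k_def ennreal_mult[symmetric])
    also have "\<dots> = ennreal (U * r)"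
      using U0 r by (simp add: nn_integral_cmult) (simp add: ennreal_mult)
    finally have S2: "(\<Sum>i\<in>GG. \<Sum>l\<in>GG. \<integral>\<^sup>+\<omega>. \<integral>\<^sup>+y. k i l (T \<omega>, y) \<partial>step_kernel GG D Qd (x' \<omega>) (x \<omega>) \<partial>M)
        \<le> ennreal (U * r)" .
    have "(\<Sum>i\<in>GG. \<Sum>l\<in>GG. \<integral>\<^sup>+\<omega>. ennreal ((norm (gi i \<omega> - gi l \<omega>))\<^sup>2) \<partial>M)
        = ennreal p * (\<Sum>i\<in>GG. \<Sum>l\<in>GG. \<integral>\<^sup>+\<omega>. ennreal ((norm (nf i (x' \<omega>) - nf l (x' \<omega>)))\<^sup>2) \<partial>M)
          + ennreal (1 - p) * (\<Sum>i\<in>GG. \<Sum>l\<in>GG. \<integral>\<^sup>+\<omega>. \<integral>\<^sup>+y. k i l (T \<omega>, y) \<partial>step_kernel GG D Qd (x' \<omega>) (x \<omega>) \<partial>M)"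
      by (simp add: one sum.distrib sum_distrib_left cong: sum.cong)
    also have "\<dots> \<le> ennreal p * ennreal (2 * G\<^sup>2 * (B * n' + \<zeta>\<^sup>2)) + ennreal (1 - p) * ennreal (U * r)"
      by (intro add_mono mult_left_mono S1 S2) auto
    also have "\<dots> = ennreal W"
      using p B n'0 U0 r unfolding W_def U_def[symmetric]
      by (simp add: ennreal_mult[symmetric] ennreal_plus[symmetric] del: ennreal_plus)
    finally show ?thesis .
  qed
  have cG: "c / (G * (G - 1)) \<ge> 0" using c G by simp
  have W2: "(\<integral>\<^sup>+\<omega>. ennreal ((norm (g' \<omega> - gbar \<omega>))\<^sup>2) \<partial>M) \<le> ennreal (c / (G * (G - 1)) * W)"
  proof -
    have "(\<integral>\<^sup>+\<omega>. ennreal ((norm (g' \<omega> - gbar \<omega>))\<^sup>2) \<partial>M) \<le> ennreal (c / (G * (G - 1))) * ennreal W"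
      using order_trans[OF R mult_left_mono[OF disp]] by (simp add: gbar_def G_def)
    also have "\<dots> = ennreal (c / (G * (G - 1)) * W)"
      using cG W0 by (rule ennreal_mult[symmetric])
    finally show ?thesis .
  qed
  have "(\<integral>\<^sup>+\<omega>. ennreal ((norm (g' \<omega> - gradf (x' \<omega>)))\<^sup>2) \<partial>M)
      \<le> (\<integral>\<^sup>+\<omega>. ennreal (1 + p / 2) * ennreal ((norm (gbar \<omega> - gradf (x' \<omega>)))\<^sup>2)
          + ennreal (1 + 2 / p) * ennreal ((norm (g' \<omega> - gbar \<omega>))\<^sup>2) \<partial>M)"
  proof (rule nn_integral_mono)
    fix \<omega>
    have "(norm (g' \<omega> - gradf (x' \<omega>)))\<^sup>2
        \<le> (1 + p / 2) * (norm (gbar \<omega> - gradf (x' \<omega>)))\<^sup>2 + (1 + 2 / p) * (norm (g' \<omega> - gbar \<omega>))\<^sup>2"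
      using norm_add_sq_le[of "p / 2" "gbar \<omega> - gradf (x' \<omega>)" "g' \<omega> - gbar \<omega>"] p by simp
    then show "ennreal ((norm (g' \<omega> - gradf (x' \<omega>)))\<^sup>2)
        \<le> ennreal (1 + p / 2) * ennreal ((norm (gbar \<omega> - gradf (x' \<omega>)))\<^sup>2)
          + ennreal (1 + 2 / p) * ennreal ((norm (g' \<omega> - gbar \<omega>))\<^sup>2)"
      using p by (simp add: ennreal_mult[symmetric] ennreal_plus[symmetric] ennreal_leI del: ennreal_plus)
  qed
  also have "\<dots> = ennreal (1 + p / 2) * (\<integral>\<^sup>+\<omega>. ennreal ((norm (gbar \<omega> - gradf (x' \<omega>)))\<^sup>2) \<partial>M)
      + ennreal (1 + 2 / p) * (\<integral>\<^sup>+\<omega>. ennreal ((norm (g' \<omega> - gbar \<omega>))\<^sup>2) \<partial>M)"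
    by (subst nn_integral_add) (simp_all add: nn_integral_cmult del: ennreal_plus)
  also have "\<dots> \<le> ennreal (1 + p / 2) * ennreal ((1 - p) * (e + V / G * r))
      + ennreal (1 + 2 / p) * ennreal (c / (G * (G - 1)) * W)"
    by (intro add_mono mult_left_mono W1 W2) auto
  also have "\<dots> = ennreal ((1 + p / 2) * ((1 - p) * (e + V / G * r)) + (1 + 2 / p) * (c / (G * (G - 1)) * W))"
    using p e r V0 G cG W0 by (simp only: ennreal_mult[symmetric] ennreal_plus[symmetric]
        mult_nonneg_nonneg add_nonneg_nonneg divide_nonneg_nonneg diff_ge_0_iff_ge less_imp_le zero_le_one zero_le_numeral
        order_trans[OF _ G])
  also have "\<dots> \<le> ennreal ((1 - p / 2) * e + 24 * c * B * n + p * A / 2 * r + 12 * c * \<zeta>\<^sup>2)"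
    unfolding W_def
    by (intro ennreal_leI error_constants[OF G p c B om s e(2) r(2) n'0 n'2 V_def])
       (use A in \<open>simp add: G_def\<close>)
  finally show ?thesis .
qed

section \<open>From the one-step bounds to the convergence rate\<close>

theorem theorem2:
  fixes M :: "'w measure"
    and F :: "nat \<Rightarrow> 'w measure"
    and n m b :: nat
    and GG BB :: "nat set"
    and \<delta> L B \<zeta> Lpm Lloc \<mu> om cR p \<gamma> A :: real
    and fij :: "nat \<Rightarrow> nat \<Rightarrow> 'v::euclidean_space \<Rightarrow> real"
    and nf :: "nat \<Rightarrow> 'v \<Rightarrow> 'v"
    and xstar :: 'v
    and D :: "nat \<Rightarrow> 'v \<Rightarrow> 'v \<Rightarrow> 'v measure"
    and Qd :: "'v \<Rightarrow> 'v measure"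
    and x g :: "nat \<Rightarrow> 'w \<Rightarrow> 'v"
    and gi q :: "nat \<Rightarrow> nat \<Rightarrow> 'w \<Rightarrow> 'v"
    and coin :: "nat \<Rightarrow> 'w \<Rightarrow> bool"
    and agg :: "'v list \<Rightarrow> 'v"
    and K :: nat
  defines "f \<equiv> (\<lambda>z. (\<Sum>i\<in>GG. (\<Sum>j<m. fij i j z) / real m) / real (card GG))"
    and "gradf \<equiv> (\<lambda>z. (1 / real (card GG)) *\<^sub>R (\<Sum>i\<in>GG. nf i z))"
  assumes
    \<comment> \<open>workers: good and Byzantine\<close>
    workers: "GG \<union> BB = {..<n}" "GG \<inter> BB = {}"
    and G2: "card GG \<ge> 2"
    and delta: "0 \<le> \<delta>" "\<delta> < 1/2" "real (card BB) \<le> \<delta> * real n"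
    \<comment> \<open>local functions, their gradients\<close>
    and m_pos: "m \<ge> 1"
    and fij_diff: "\<And>i j z. i \<in> GG \<Longrightarrow> j < m \<Longrightarrow> fij i j differentiable (at z)"
    and nf_grad: "\<And>i z. i \<in> GG \<Longrightarrow> GDERIV (\<lambda>y. (\<Sum>j<m. fij i j y) / real m) z :> nf i z"
    \<comment> \<open>(A1)\<close>
    and A1: "\<And>y z. norm (gradf y - gradf z) \<le> L * norm (y - z)"
    and A1_bdd: "bdd_below (range f)"
    \<comment> \<open>(A2)\<close>
    and B_nonneg: "B \<ge> 0" and zeta_nonneg: "\<zeta> \<ge> 0"
    and A2: "\<And>z. (\<Sum>i\<in>GG. (norm (nf i z - gradf z))\<^sup>2) / real (card GG)
                  \<le> B * (norm (gradf z))\<^sup>2 + \<zeta>\<^sup>2"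
    \<comment> \<open>(A3)\<close>
    and Lpm_nonneg: "Lpm \<ge> 0"
    and A3: "\<And>y z. (\<Sum>i\<in>GG. (norm (nf i y - nf i z))\<^sup>2) / real (card GG)
                    - (norm (gradf y - gradf z))\<^sup>2 \<le> Lpm\<^sup>2 * (norm (y - z))\<^sup>2"
    \<comment> \<open>(A4): D i y z is the law of the estimator hat Delta_i(y,z)\<close>
    and b_pos: "b \<ge> 1" and Lloc_nonneg: "Lloc \<ge> 0"
    and D_kernel: "\<And>i. i \<in> GG \<Longrightarrow> (\<lambda>(y, z). D i y z) \<in> borel \<rightarrow>\<^sub>M prob_algebra borel"
    and A4_int: "\<And>i y z. i \<in> GG \<Longrightarrow> integrable (D i y z) (\<lambda>v. v)"
    and A4_mean: "\<And>i y z. i \<in> GG \<Longrightarrow> (\<integral>v. v \<partial>D i y z) = nf i y - nf i z"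
    and A4_var: "\<And>y z. ennreal (1 / real (card GG)) *
                   (\<Sum>i\<in>GG. \<integral>\<^sup>+v. ennreal ((norm (v - (nf i y - nf i z)))\<^sup>2) \<partial>D i y z)
                 \<le> ennreal (Lloc\<^sup>2 / real b * (norm (y - z))\<^sup>2)"
    \<comment> \<open>(A5) Polyak-Lojasiewicz\<close>
    and mu_pos: "\<mu> > 0"
    and A5: "\<And>z. \<exists>xs. (\<forall>y. f xs \<le> f y) \<and> (norm (gradf z))\<^sup>2 \<ge> 2 * \<mu> * (f z - f xs)"
    and xstar_min: "\<And>y. f xstar \<le> f y"
    \<comment> \<open>compressor: Qd v is the law of Q(v)\<close>
    and om_nonneg: "om \<ge> 0"
    and Q_kernel: "Qd \<in> borel \<rightarrow>\<^sub>M prob_algebra borel"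
    and Q_int: "\<And>v. integrable (Qd v) (\<lambda>u. u)"
    and Q_mean: "\<And>v. (\<integral>u. u \<partial>Qd v) = v"
    and Q_var: "\<And>v. (\<integral>\<^sup>+u. ennreal ((norm (u - v))\<^sup>2) \<partial>Qd v) \<le> ennreal (om * (norm v)\<^sup>2)"
    \<comment> \<open>probability space and filtration of the past\<close>
    and M_prob: "prob_space M"
    and F_sub: "\<And>k. subalgebra M (F k)"
    and F_mono: "\<And>k. sets (F k) \<subseteq> sets (F (Suc k))"
    and x_meas: "\<And>k. x k \<in> borel_measurable (F k)"
    and g_meas: "\<And>k. g k \<in> borel_measurable (F k)"
    and q_meas: "\<And>k i. i \<in> GG \<Longrightarrow> q k i \<in> borel_measurable M"
    and coin_meas: "\<And>k. coin k \<in> M \<rightarrow>\<^sub>M count_space UNIV"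
    and byz_meas: "\<And>k i. i \<in> BB \<Longrightarrow> gi k i \<in> borel_measurable M"
    \<comment> \<open>Byz-VR-MARINA\<close>
    and p_range: "0 < p" "p \<le> 1"
    and coin_bern: "\<And>k A. A \<in> sets (F k) \<Longrightarrow>
        measure M (A \<inter> {\<omega>\<in>space M. coin k \<omega>}) = p * measure M A"
    and q_law: "\<And>k A c S. A \<in> sets (F k) \<Longrightarrow> S \<in> sets (PiM GG (\<lambda>_. borel)) \<Longrightarrow>
        measure M (A \<inter> {\<omega>\<in>space M. coin k \<omega> = c} \<inter> {\<omega>\<in>space M. (\<lambda>i\<in>GG. q k i \<omega>) \<in> S})
        = (\<integral>\<omega>\<in>(A \<inter> {\<omega>\<in>space M. coin k \<omega> = c}).
              measure (step_kernel GG D Qd (x (Suc k) \<omega>) (x k \<omega>)) S \<partial>M)"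
    and x_step: "\<And>k \<omega>. \<omega> \<in> space M \<Longrightarrow> x (Suc k) \<omega> = x k \<omega> - \<gamma> *\<^sub>R g k \<omega>"
    and good_step: "\<And>k i \<omega>. i \<in> GG \<Longrightarrow> \<omega> \<in> space M \<Longrightarrow>
        gi (Suc k) i \<omega> = (if coin k \<omega> then nf i (x (Suc k) \<omega>) else g k \<omega> + q k i \<omega>)"
    and agg_step: "\<And>k \<omega>. \<omega> \<in> space M \<Longrightarrow>
        g (Suc k) \<omega> = agg (map (\<lambda>i. gi (Suc k) i \<omega>) [0..<n])"
    \<comment> \<open>robustness (R) of the aggregator\<close>
    and cR_pos: "cR > 0"
    and R: "\<And>k. (\<integral>\<^sup>+\<omega>. ennreal ((norm (g (Suc k) \<omega>
                 - (1 / real (card GG)) *\<^sub>R (\<Sum>i\<in>GG. gi (Suc k) i \<omega>)))\<^sup>2) \<partial>M)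
         \<le> ennreal (cR * \<delta> / (real (card GG) * (real (card GG) - 1))) *
           (\<Sum>i\<in>GG. \<Sum>l\<in>GG. \<integral>\<^sup>+\<omega>. ennreal ((norm (gi (Suc k) i \<omega> - gi (Suc k) l \<omega>))\<^sup>2) \<partial>M)"
    \<comment> \<open>constants and stepsize\<close>
    and A_def: "A = 48 * B * L\<^sup>2 * cR * \<delta> / p
        + 6 * (1 - p) / p * (4 * cR * \<delta> / p + 1 / (2 * real (card GG)))
            * (om * L\<^sup>2 + (1 + om) * Lloc\<^sup>2 / real b)
        + 6 * (1 - p) / p * (4 * cR * \<delta> * (1 + om) / p + om / (2 * real (card GG))) * Lpm\<^sup>2"
    and small_B: "96 * cR * B * \<delta> < p"
    and gamma_pos: "0 < \<gamma>"
    and gamma_le: "\<gamma> \<le> min (1 / (L + sqrt (2 * A))) (p / (4 * \<mu> * (1 - 96 * B * cR * \<delta> / p)))"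
  shows "(\<integral>\<^sup>+\<omega>. ennreal (f (x K \<omega>) - f xstar) \<partial>M)
    \<le> ennreal ((1 - \<gamma> * \<mu> * (1 - 96 * B * cR * \<delta> / p)) ^ K)
        * (\<integral>\<^sup>+\<omega>. ennreal (f (x 0 \<omega>) - f xstar
              + 2 * \<gamma> / p * (norm (g 0 \<omega> - gradf (x 0 \<omega>)))\<^sup>2) \<partial>M)
      + ennreal (24 * cR * \<delta> * \<zeta>\<^sup>2 / (\<mu> * (p - 96 * B * cR * \<delta>)))"
proof -
  interpret prob_space M by (rule M_prob)
  define G where "G = real (card GG)"
  have fin: "finite GG" using workers(1) by (metis finite_Un finite_lessThan)
  define c where "c = cR * \<delta>"
  have c: "c \<ge> 0" using cR_pos delta by (simp add: c_def)
  define \<theta> where "\<theta> = 1 - 96 * B * cR * \<delta> / p"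
  have \<theta>: "\<theta> > 0" using small_B p_range by (simp add: \<theta>_def field_simps)
  define s where "s = Lloc\<^sup>2 / real b"
  have s: "s \<ge> 0" by (simp add: s_def)
  have A: "A = 48 * B * L\<^sup>2 * c / p
        + 6 * (1 - p) / p * (4 * c / p + 1 / (2 * real (card GG))) * (om * L\<^sup>2 + (1 + om) * s)
        + 6 * (1 - p) / p * (4 * c * (1 + om) / p + om / (2 * real (card GG))) * Lpm\<^sup>2"
    unfolding A_def by (simp add: c_def s_def mult.assoc)
  have A0: "A \<ge> 0"
    unfolding A using B_nonneg c p_range om_nonneg s by (intro add_nonneg_nonneg mult_nonneg_nonneg divide_nonneg_nonneg) auto
  \<comment> \<open>The Lipschitz inequality yields a sign for \<open>L\<close> as soon as there are
    two distinct points; a basis vector and 0 serve.\<close>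
  have L0: "L \<ge> 0"
  proof -
    obtain z :: 'v where "z \<in> Basis" using nonempty_Basis by blast
    then have "norm (z - 0) > 0" by (simp add: nonzero_Basis)
    moreover have "0 \<le> L * norm (z - 0)" by (rule order_trans[OF norm_ge_zero A1])
    ultimately show ?thesis by (simp add: zero_le_mult_iff)
  qed
  have \<gamma>1: "2 * \<gamma>\<^sup>2 * A + \<gamma> * L \<le> 1"
    using L0 A0 gamma_pos gamma_le by (intro stepsize_quadratic) auto
  have \<gamma>2: "\<gamma> * \<mu> * \<theta> \<le> p / 4"
    using gamma_le mu_pos \<theta> unfolding \<theta>_def[symmetric] by (simp add: field_simps)
  \<comment> \<open>Its sign matters because \<open>ennreal\<close> sends negative numbers to 0, so
    the step-length term of the descent inequality can be kept faithfully only with a nonnegative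
    coefficient.\<close>
  define c1 where "c1 = 1 / (2 * \<gamma>) - L / 2"
  have c1: "c1 \<ge> 0"
  proof -
    have "\<gamma> * L \<le> 1" using \<gamma>1 A0 by (smt (verit) mult_nonneg_nonneg zero_le_power2)
    then show ?thesis using gamma_pos by (simp add: c1_def field_simps)
  qed
  define \<rho> where "\<rho> = 1 - \<gamma> * \<mu> * \<theta>"
  \<comment> \<open>Strict positivity ensures that \<open>\<rho> ^ K\<close> times an infinite
    initial value is still infinite.\<close>
  have \<rho>: "\<rho> > 0" using \<gamma>2 p_range by (simp add: \<rho>_def)

  have grad: "GDERIV f z :> gradf z" for z
  proof -
    have "((\<lambda>y. (1 / G) *\<^sub>R (\<Sum>i\<in>GG. (\<Sum>j<m. fij i j y) / real m)) has_derivative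
        (\<lambda>h. (1 / G) *\<^sub>R (\<Sum>i\<in>GG. h \<bullet> nf i z))) (at z)"
      using nf_grad unfolding gderiv_def by (intro has_derivative_scaleR_right has_derivative_sum) auto
    then show ?thesis
      unfolding gderiv_def f_def gradf_def G_def by (simp add: inner_sum_right)
  qed
  have "isCont f z" for z
    using grad[of z] unfolding gderiv_def by (rule has_derivative_continuous)
  then have f_meas[measurable]: "f \<in> borel_measurable borel"
    by (intro borel_measurable_continuous_onI continuous_at_imp_continuous_on) auto
  have gradf_meas[measurable]: "gradf \<in> borel_measurable borel"
  proof (rule borel_measurable_continuous_onI, rule lipschitz_on_continuous_on)
    show "L-lipschitz_on UNIV gradf"
      using A1 L0 by (intro lipschitz_onI) (auto simp: dist_norm)
  qed
  \<comment> \<open>The minimizer in (A5) may vary with \<open>z\<close>, but all minimizers share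
    the value \<open>f xstar\<close>.\<close>
  have PLz: "2 * \<mu> * (f z - f xstar) \<le> (norm (gradf z))\<^sup>2" for z
  proof -
    obtain xs where xs: "\<And>y. f xs \<le> f y" "(norm (gradf z))\<^sup>2 \<ge> 2 * \<mu> * (f z - f xs)"
      using A5 by blast
    then have "f xs = f xstar" using xstar_min by (simp add: order_antisym)
    with xs(2) show ?thesis by simp
  qed

  have spF: "space (F k) = space M" for k using F_sub[of k] by (simp add: subalgebra_def)
  have xM[measurable]: "x k \<in> borel_measurable M" and gM[measurable]: "g k \<in> borel_measurable M" for k
    by (rule measurable_from_subalg[OF F_sub x_meas], rule measurable_from_subalg[OF F_sub g_meas])
  \<comment> \<open>The next iterate is determined by \<open>x k\<close> and \<open>g k\<close>, so
    it belongs to the past when the coin \<open>k\<close> is tossed.\<close>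
  have xSuc: "x (Suc k) \<in> borel_measurable (F k)" for k
  proof -
    have "(\<lambda>\<omega>. x k \<omega> - \<gamma> *\<^sub>R g k \<omega>) \<in> borel_measurable (F k)"
      using x_meas[of k] g_meas[of k] by measurable
    then show ?thesis by (rule measurable_cong[THEN iffD2, rotated]) (rule x_step, simp add: spF)
  qed

  define a where "a k = (\<integral>\<^sup>+\<omega>. ennreal (f (x k \<omega>) - f xstar) \<partial>M)" for k
  define e where "e k = (\<integral>\<^sup>+\<omega>. ennreal ((norm (g k \<omega> - gradf (x k \<omega>)))\<^sup>2) \<partial>M)" for k
  define r where "r k = (\<integral>\<^sup>+\<omega>. ennreal ((norm (x (Suc k) \<omega> - x k \<omega>))\<^sup>2) \<partial>M)" for k
  define N where "N k = (\<integral>\<^sup>+\<omega>. ennreal ((norm (gradf (x k \<omega>)))\<^sup>2) \<partial>M)" for k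

  have descent: "a (Suc k) + ennreal (\<gamma> / 2) * N k + ennreal c1 * r k \<le> a k + ennreal (\<gamma> / 2) * e k" for k
  proof -
    have "a (Suc k) + ennreal (\<gamma> / 2) * N k + ennreal c1 * r k
        = (\<integral>\<^sup>+\<omega>. ennreal (f (x (Suc k) \<omega>) - f xstar) + ennreal (\<gamma> / 2) * ennreal ((norm (gradf (x k \<omega>)))\<^sup>2)
          + ennreal c1 * ennreal ((norm (x (Suc k) \<omega> - x k \<omega>))\<^sup>2) \<partial>M)"
      by (simp add: a_def N_def r_def nn_integral_add nn_integral_cmult)
    also have "\<dots> \<le> (\<integral>\<^sup>+\<omega>. ennreal (f (x k \<omega>) - f xstar)
        + ennreal (\<gamma> / 2) * ennreal ((norm (g k \<omega> - gradf (x k \<omega>)))\<^sup>2) \<partial>M)"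
    proof (rule nn_integral_mono)
      fix \<omega> assume \<omega>: "\<omega> \<in> space M"
      have "f (x (Suc k) \<omega>) - f xstar + \<gamma> / 2 * (norm (gradf (x k \<omega>)))\<^sup>2 + c1 * (norm (x (Suc k) \<omega> - x k \<omega>))\<^sup>2
          \<le> f (x k \<omega>) - f xstar + \<gamma> / 2 * (norm (g k \<omega> - gradf (x k \<omega>)))\<^sup>2"
        using inexact_gradient_descent[OF grad A1 gamma_pos x_step[OF \<omega>], of k] by (simp add: c1_def)
      then show "ennreal (f (x (Suc k) \<omega>) - f xstar) + ennreal (\<gamma> / 2) * ennreal ((norm (gradf (x k \<omega>)))\<^sup>2)
          + ennreal c1 * ennreal ((norm (x (Suc k) \<omega> - x k \<omega>))\<^sup>2)
        \<le> ennreal (f (x k \<omega>) - f xstar) + ennreal (\<gamma> / 2) * ennreal ((norm (g k \<omega> - gradf (x k \<omega>)))\<^sup>2)"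
        using c1 gamma_pos xstar_min
        by (simp add: ennreal_mult[symmetric] ennreal_plus[symmetric] ennreal_leI del: ennreal_plus)
    qed
    also have "\<dots> = a k + ennreal (\<gamma> / 2) * e k"
      by (simp add: a_def e_def nn_integral_add nn_integral_cmult)
    finally show ?thesis .
  qed
  \<comment> \<open>This serves finiteness only: \<open>c1\<close> may be 0, in which case the
    descent inequality says nothing about \<open>r k\<close>.\<close>
  have step_bound: "r k \<le> ennreal (2 * \<gamma>\<^sup>2) * (e k + N k)" for k
  proof -
    have "r k \<le> (\<integral>\<^sup>+\<omega>. ennreal (2 * \<gamma>\<^sup>2) *
        (ennreal ((norm (g k \<omega> - gradf (x k \<omega>)))\<^sup>2) + ennreal ((norm (gradf (x k \<omega>)))\<^sup>2)) \<partial>M)"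
      unfolding r_def
    proof (rule nn_integral_mono)
      fix \<omega> assume \<omega>: "\<omega> \<in> space M"
      have "(norm (x (Suc k) \<omega> - x k \<omega>))\<^sup>2 = \<gamma>\<^sup>2 * (norm ((g k \<omega> - gradf (x k \<omega>)) + gradf (x k \<omega>)))\<^sup>2"
        by (simp add: x_step[OF \<omega>] power_mult_distrib)
      also have "\<dots> \<le> \<gamma>\<^sup>2 * (2 * (norm (g k \<omega> - gradf (x k \<omega>)))\<^sup>2 + 2 * (norm (gradf (x k \<omega>)))\<^sup>2)"
        by (intro mult_left_mono norm_add_sq_le_double) simp
      finally have "(norm (x (Suc k) \<omega> - x k \<omega>))\<^sup>2
          \<le> 2 * \<gamma>\<^sup>2 * ((norm (g k \<omega> - gradf (x k \<omega>)))\<^sup>2 + (norm (gradf (x k \<omega>)))\<^sup>2)"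
        by (simp add: algebra_simps)
      then show "ennreal ((norm (x (Suc k) \<omega> - x k \<omega>))\<^sup>2) \<le> ennreal (2 * \<gamma>\<^sup>2) *
        (ennreal ((norm (g k \<omega> - gradf (x k \<omega>)))\<^sup>2) + ennreal ((norm (gradf (x k \<omega>)))\<^sup>2))"
        by (simp add: ennreal_mult[symmetric] ennreal_plus[symmetric] ennreal_leI del: ennreal_plus)
    qed
    also have "\<dots> = ennreal (2 * \<gamma>\<^sup>2) * (e k + N k)"
      by (simp add: e_def N_def nn_integral_add nn_integral_cmult)
    finally show ?thesis .
  qed
  \<comment> \<open>Real representatives of the three moments are parameters here, so the bound can
    be used both to propagate finiteness and, afterwards, in the real recursion.\<close>
  have error: "e (Suc k) \<le> ennreal ((1 - p / 2) * e' + 24 * c * B * n' + p * A / 2 * r' + 12 * c * \<zeta>\<^sup>2)"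
    if e': "e k = ennreal e'" "e' \<ge> 0" and n': "N k = ennreal n'" "n' \<ge> 0" and r': "r k = ennreal r'" "r' \<ge> 0"
    for k e' n' r'
    unfolding e_def
    by (rule marina_error_step[OF meta_eq_to_obj_eq[OF gradf_def] M_prob F_sub[of k] fin G2 A1 B_nonneg A2 A3 s
          D_kernel A4_int A4_mean A4_var[folded s_def] om_nonneg Q_kernel Q_int Q_mean Q_var p_range
          x_meas xSuc g_meas gM q_meas coin_meas coin_bern q_law good_step c
          R[unfolded c_def[symmetric]] A e'(1)[unfolded e_def] e'(2) n'(1)[unfolded N_def] n'(2)
          r'(1)[unfolded r_def] r'(2)])

  have \<Phi>0: "(\<integral>\<^sup>+\<omega>. ennreal (f (x 0 \<omega>) - f xstar + 2 * \<gamma> / p * (norm (g 0 \<omega> - gradf (x 0 \<omega>)))\<^sup>2) \<partial>M)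
      = a 0 + ennreal (2 * \<gamma> / p) * e 0"
  proof -
    have "(\<integral>\<^sup>+\<omega>. ennreal (f (x 0 \<omega>) - f xstar + 2 * \<gamma> / p * (norm (g 0 \<omega> - gradf (x 0 \<omega>)))\<^sup>2) \<partial>M)
      = (\<integral>\<^sup>+\<omega>. ennreal (f (x 0 \<omega>) - f xstar) + ennreal (2 * \<gamma> / p) * ennreal ((norm (g 0 \<omega> - gradf (x 0 \<omega>)))\<^sup>2) \<partial>M)"
      using gamma_pos p_range xstar_min
      by (intro nn_integral_cong) (simp add: ennreal_mult[symmetric] ennreal_plus[symmetric] del: ennreal_plus)
    then show ?thesis by (simp add: a_def e_def nn_integral_add nn_integral_cmult)
  qed
  \<comment> \<open>With an infinite initial Lyapunov value the right-hand side is infinite.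
    Otherwise all moments stay finite and the argument moves to real sequences.\<close>
  show ?thesis
  proof (cases "a 0 + ennreal (2 * \<gamma> / p) * e 0 = \<infinity>")
    case True
    have "ennreal (\<rho> ^ K) * \<infinity> = \<infinity>"
      using \<rho> by (simp add: ennreal_mult_eq_top_iff)
    then show ?thesis unfolding \<Phi>0 True \<rho>_def \<theta>_def by simp
  next
    case False
    have gp: "2 * \<gamma> / p > 0" using gamma_pos p_range by simp
    from False have fin0: "a 0 < \<infinity>" "e 0 < \<infinity>"
      using gp by (auto simp: less_top[symmetric] ennreal_mult_eq_top_iff)
    have Nr: "N k < \<infinity> \<and> r k < \<infinity> \<and> a (Suc k) < \<infinity>" if "a k < \<infinity>" "e k < \<infinity>" for k
    proof -
      have "a k + ennreal (\<gamma> / 2) * e k < \<infinity>"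
        using that by (simp add: ennreal_mult_less_top)
      with descent[of k] have 1: "a (Suc k) + ennreal (\<gamma> / 2) * N k + ennreal c1 * r k < \<infinity>"
        by (rule le_less_trans)
      then have N: "N k < \<infinity>" using gamma_pos by (auto simp: ennreal_mult_less_top)
      have "ennreal (2 * \<gamma>\<^sup>2) * (e k + N k) < \<infinity>"
        using that N by (simp add: ennreal_mult_less_top)
      with step_bound[of k] have "r k < \<infinity>" by (rule le_less_trans)
      with 1 N show ?thesis by simp
    qed
    have er: "ennreal (enn2real u) = u" if "u < \<infinity>" for u
      using that by simp
    have finite: "a k < \<infinity> \<and> e k < \<infinity>" for k
    proof (induction k)
      case (Suc k)
      then have ae: "a k < \<infinity>" "e k < \<infinity>" by auto
      note Nr = Nr[OF ae]
      have "e (Suc k) < \<infinity>"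
        by (rule le_less_trans[OF error[OF er[OF ae(2), symmetric] _ er[of "N k", symmetric] _ er[of "r k", symmetric]]])
          (use Nr in auto)
      then show ?case using Nr by simp
    qed (use fin0 in simp)
    define a' where "a' k = enn2real (a k)" for k
    define e' where "e' k = enn2real (e k)" for k
    define r' where "r' k = enn2real (r k)" for k
    define N' where "N' k = enn2real (N k)" for k
    have real: "a k = ennreal (a' k)" "e k = ennreal (e' k)" "r k = ennreal (r' k)" "N k = ennreal (N' k)" for k
      using finite[of k] Nr[of k] by (auto simp: a'_def e'_def r'_def N'_def)
    have nn: "a' k \<ge> 0" "e' k \<ge> 0" "r' k \<ge> 0" "N' k \<ge> 0" for k
      by (auto simp: a'_def e'_def r'_def N'_def)
    define \<eta> where "\<eta> = 12 * c * \<zeta>\<^sup>2"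
    have \<eta>: "\<eta> \<ge> 0" using c by (simp add: \<eta>_def)
    have rec: "a' K + 2 * \<gamma> / p * e' K
        \<le> (1 - \<gamma> * \<mu> * \<theta>) ^ K * (a' 0 + 2 * \<gamma> / p * e' 0) + 2 * \<eta> / (p * \<mu> * \<theta>)"
    proof (rule lyapunov_recursion[where L = L and A = A and r = r' and N = N'])
      show "a' (Suc k) + \<gamma> / 2 * N' k + (1 / (2 * \<gamma>) - L / 2) * r' k \<le> a' k + \<gamma> / 2 * e' k" for k
        using descent[of k] gamma_pos c1 nn unfolding real c1_def[symmetric]
        by (simp add: ennreal_mult[symmetric] ennreal_plus[symmetric] del: ennreal_plus)
      show "e' (Suc k) \<le> (1 - p / 2) * e' k + p * (1 - \<theta>) / 4 * N' k + p * A / 2 * r' k + \<eta>" for k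
      proof -
        have "0 \<le> (1 - p / 2) * e' k + 24 * c * B * N' k + p * A / 2 * r' k + 12 * c * \<zeta>\<^sup>2"
          using p_range c B_nonneg A0 nn by simp
        with error[OF real(2) nn(2) real(4) nn(4) real(3) nn(3), of k]
        have "e' (Suc k) \<le> (1 - p / 2) * e' k + 24 * c * B * N' k + p * A / 2 * r' k + 12 * c * \<zeta>\<^sup>2"
          unfolding real by (simp add: ennreal_le_iff del: ennreal_plus)
        \<comment> \<open>This identity explains the 96 in \<open>\<theta>\<close>: it is 24 times
          4, the 4 coming from the ratio of \<open>\<gamma> / 2\<close> to the weight
          \<open>2 * \<gamma> / p\<close>.\<close>
        moreover have "p * (1 - \<theta>) / 4 = 24 * c * B"
          using p_range by (simp add: \<theta>_def c_def)
        ultimately show ?thesis by (simp only: \<eta>_def)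
      qed
      show "2 * \<mu> * a' k \<le> N' k" for k
      proof -
        have "ennreal (2 * \<mu>) * a k = (\<integral>\<^sup>+\<omega>. ennreal (2 * \<mu>) * ennreal (f (x k \<omega>) - f xstar) \<partial>M)"
          by (simp add: a_def nn_integral_cmult)
        also have "\<dots> \<le> N k"
          unfolding N_def using PLz mu_pos xstar_min
          by (intro nn_integral_mono) (simp add: ennreal_mult[symmetric] ennreal_leI)
        finally show ?thesis
          unfolding real using mu_pos nn by (simp add: ennreal_mult[symmetric])
      qed
    qed (use nn p_range \<theta> gamma_pos mu_pos \<gamma>1 \<gamma>2 \<eta> in auto)
    have "p - 96 * B * cR * \<delta> = p * \<theta>" using p_range by (simp add: \<theta>_def right_diff_distrib)
    then have noise: "24 * cR * \<delta> * \<zeta>\<^sup>2 / (\<mu> * (p - 96 * B * cR * \<delta>)) = 2 * \<eta> / (p * \<mu> * \<theta>)"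
      by (simp add: \<eta>_def c_def mult_ac)
    have E0: "2 * \<eta> / (p * \<mu> * \<theta>) \<ge> 0" using \<eta> p_range mu_pos \<theta> by simp
    \<comment> \<open>The recursion controls the whole Lyapunov value; the nonnegative error part is
      discarded only at the final index.\<close>
    have "a K \<le> ennreal (a' K + 2 * \<gamma> / p * e' K)"
      unfolding real using mult_nonneg_nonneg[OF less_imp_le[OF gp] nn(2)[of K]] by (intro ennreal_leI) simp
    also have "\<dots> \<le> ennreal (\<rho> ^ K * (a' 0 + 2 * \<gamma> / p * e' 0) + 2 * \<eta> / (p * \<mu> * \<theta>))"
      using rec unfolding \<rho>_def by (rule ennreal_leI)
    also have "\<dots> = ennreal (\<rho> ^ K) * (ennreal (a' 0) + ennreal (2 * \<gamma> / p) * ennreal (e' 0)) + ennreal (2 * \<eta> / (p * \<mu> * \<theta>))"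
    proof -
      have gp': "2 * \<gamma> / p \<ge> 0" and "\<rho> ^ K \<ge> 0" using gp \<rho> by simp_all
      moreover note ge = mult_nonneg_nonneg[OF gp' nn(2)[of 0]]
      moreover note add_nonneg_nonneg[OF nn(1)[of 0] ge]
      ultimately show ?thesis
        using nn E0 by (simp only: ennreal_mult ennreal_plus mult_nonneg_nonneg)
    qed
    finally have "a K \<le> ennreal (\<rho> ^ K) * (a 0 + ennreal (2 * \<gamma> / p) * e 0) + ennreal (2 * \<eta> / (p * \<mu> * \<theta>))"
      unfolding real[symmetric] .
    then show ?thesis
      unfolding \<Phi>0 noise unfolding a_def \<rho>_def \<theta>_def .
  qed
qed

end
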